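(* Fix $\alpha\in(0,1)$, integers $d\ge 1$, $b\ge 2$, $t\ge 0$, and a parameter set $\Theta\subset\mathbb{R}$. For $\theta\in\Theta$ let $g_\theta:(0,1)^d\to\mathbb{R}$ be measurable, and let $F$ denote the CDF of the random loss $L=g_\theta(\boldsymbol u)$ with $\boldsymbol u\sim \mathrm{Unif}((0,1)^d)$. Let $v_\alpha=v_\alpha(\theta)=\inf\{y\in\mathbb{R}:F(y)\ge\alpha\}$. Assume that for every $\theta\in\Theta$, $v_\alpha(\theta)$ is the unique solution $x$ of $F(x-)\le \alpha\le F(x)$. For each $m\ge t$ let $\boldsymbol u_1,\dots,\boldsymbol u_n$, $n=b^m$, be a scrambled $(t,m,d)$-net in base $b$, let $L_i=g_\theta(\boldsymbol u_i)$, $\hat F_n(y)=\frac1n\sum_{i=1}^n\mathbf 1\{L_i\le y\}$ and $\hat v_{\alpha,n}=\inf\{y\in\mathbb{R}:\hat F_n(y)\ge\alpha\}$. Then $$\mathbb{P}\Big(\lim_{n\to\infty}\hat v_{\alpha,n}=v_\alpha\Big)=1,$$ where $n=b^m\to\infty$ as $m\to\infty$.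
   Context: An elementary interval in base $b$ is a set $\prod_{j=1}^d[t_j b^{-k_j},(t_j+1)b^{-k_j})$ with nonnegative integers $k_j$ and $0\le t_j<b^{k_j}$. For integers $0\le t\le m$, a finite sequence $\boldsymbol u_1,\dots,\boldsymbol u_{b^m}\in[0,1)^d$ is a $(t,m,d)$-net in base $b$ if every elementary interval in base $b$ of volume $b^{t-m}$ contains exactly $b^t$ of the points. A scrambled net is obtained from a $(t,m,d)$-net by Owen's nested uniform scrambling: writing each coordinate $u_i^j=\sum_{k\ge1}a_{ijk}b^{-k}$ in base $b$, the scrambled coordinate is $\tilde u_i^j=\sum_{k\ge1}\tilde a_{ijk}b^{-k}$ with $\tilde a_{ij1}=\pi_j(a_{ij1})$ and in general $\tilde a_{ijk}=\pi_{j a_{ij1}\cdots a_{ij,k-1}}(a_{ijk})$, where the permutations $\pi_\bullet$ are mutually independent and each uniformly distributed over the $b!$ permutations of $\{0,\dots,b-1\}$. $F(x-)$ denotes the left limit of $F$ at $x$. *)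

theory Defs
  imports "HOL-Probability.Probability" "HOL-Combinatorics.Permutations"
begin

text \<open>Base-b digits: the k-th digit (k >= 1) of x in [0,1) is floor(b^k x) mod b
  (the standard expansion, not ending in infinitely many b-1).\<close>
definition digit :: "nat \<Rightarrow> nat \<Rightarrow> real \<Rightarrow> nat" where
  "digit b k x = nat (\<lfloor>x * real b ^ k\<rfloor> mod int b)"

definition elem_interval :: "nat \<Rightarrow> ('d \<Rightarrow> nat) \<Rightarrow> ('d \<Rightarrow> nat) \<Rightarrow> (real^'d) set" where
  "elem_interval b k c =
     {x. \<forall>j. real (c j) / real b ^ k j \<le> x$j \<and> x$j < real (c j + 1) / real b ^ k j}"

text \<open>(t,m,d)-net in base b, d = CARD('d), points P 0, ..., P (b^m - 1).
  An elementary interval has volume b^(-sum k), which equals b^(t-m) iff sum k = m - t.\<close>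
definition is_net :: "nat \<Rightarrow> nat \<Rightarrow> nat \<Rightarrow> (nat \<Rightarrow> real^'d) \<Rightarrow> bool" where
  "is_net b t m P \<longleftrightarrow> t \<le> m \<and>
     (\<forall>i<b^m. \<forall>j. 0 \<le> P i $ j \<and> P i $ j < 1) \<and>
     (\<forall>k c. (\<Sum>j\<in>UNIV. k j) = m - t \<longrightarrow> (\<forall>j. c j < b ^ k j) \<longrightarrow>
        card {i\<in>{..<b^m}. P i \<in> elem_interval b k c} = b ^ t)"

text \<open>Owen's nested uniform scrambling with permutations \<pi> indexed by (coordinate j,
  prefix of digits a_1..a_(k-1)).\<close>
definition scramble_coord :: "nat \<Rightarrow> ('d \<times> nat list \<Rightarrow> nat \<Rightarrow> nat) \<Rightarrow> 'd \<Rightarrow> real \<Rightarrow> real" where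
  "scramble_coord b \<pi> j x =
     (\<Sum>k. real (\<pi> (j, map (\<lambda>l. digit b l x) [1..<Suc k]) (digit b (Suc k) x)) / real b ^ Suc k)"

definition scramble :: "nat \<Rightarrow> ('d \<times> nat list \<Rightarrow> nat \<Rightarrow> nat) \<Rightarrow> real^'d \<Rightarrow> real^'d" where
  "scramble b \<pi> u = (\<chi> j. scramble_coord b \<pi> j (u $ j))"

definition perm_space :: "nat \<Rightarrow> ('d \<times> nat list \<Rightarrow> nat \<Rightarrow> nat) measure" where
  "perm_space b = PiM UNIV (\<lambda>_. measure_pmf (pmf_of_set {p. p permutes {..<b}}))"

definition unif_cdf :: "(real^'d \<Rightarrow> real) \<Rightarrow> real \<Rightarrow> real" where
  "unif_cdf h y = measure (uniform_measure lborel (box 0 One)) {u \<in> box 0 One. h u \<le> y}"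

definition left_lim :: "(real \<Rightarrow> real) \<Rightarrow> real \<Rightarrow> real" where
  "left_lim F x = Lim (at_left x) F"

definition quantile :: "real \<Rightarrow> (real \<Rightarrow> real) \<Rightarrow> real" where
  "quantile \<alpha> F = Inf {y. \<alpha> \<le> F y}"

definition emp_cdf :: "nat \<Rightarrow> (nat \<Rightarrow> real) \<Rightarrow> real \<Rightarrow> real" where
  "emp_cdf n L y = real (card {i\<in>{..<n}. L i \<le> y}) / real n"

end

theory Submission
  imports Defs
begin

text \<open>It suffices that the empirical measure of every Borel set \<open>A\<close> converges almost surely, because
  the uniqueness assumption says that the distribution function lies strictly below \<open>\<alpha>\<close> to the left
  of the quantile and strictly above \<open>\<alpha>\<close> to the right of it. No joint law of the scramblings for
  different \<open>m\<close> is given, so convergence has to come from summable second moments.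

  Write a square integrable \<open>f\<close> as \<open>p + h\<close>, where \<open>p\<close> is its orthogonal projection onto the span of
  the indicators of all elementary intervals of volume \<open>b\<close> to the power \<open>t - m\<close>. Scrambling
  preserves the net property, so the net integrates \<open>p\<close> exactly. If there is a shape of such
  intervals for which two points lie in different digit cells in every coordinate, then conditionally
  on one scrambled point and on the cell of the other one, the latter is uniform in its elementary
  interval, on which \<open>h\<close> has mean zero; hence \<open>h\<close> is uncorrelated at the two scrambled points.
  The net property bounds the number of partners violating this, for a given point, by a power of
  \<open>m + 1\<close>, which gives a variance of order \<open>(m + 1)\<close> to the power \<open>d\<close> times \<open>b\<close> to the power
  \<open>- m\<close>.\<close>

section \<open>Radix expansions\<close>

definition cell_index :: "nat \<Rightarrow> nat \<Rightarrow> real \<Rightarrow> int" where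
  "cell_index b K x = \<lfloor>x * real b ^ K\<rfloor>"

definition digit_prefix :: "nat \<Rightarrow> real \<Rightarrow> nat \<Rightarrow> nat list" where
  "digit_prefix b x K = map (\<lambda>l. digit b l x) [1..<Suc K]"

primrec digit_value :: "nat \<Rightarrow> (nat \<Rightarrow> nat) \<Rightarrow> nat \<Rightarrow> nat" where
  "digit_value b d 0 = 0"
| "digit_value b d (Suc K) = b * digit_value b d K + d K"

text \<open>Digit sequences are indexed from \<open>0\<close>, whereas \<^const>\<open>digit\<close> counts from \<open>1\<close>.\<close>

definition digit_series :: "nat \<Rightarrow> (nat \<Rightarrow> nat) \<Rightarrow> real" where
  "digit_series b d = (\<Sum>k. real (d k) / real b ^ Suc k)"

lemma length_digit_prefix [simp]: "length (digit_prefix b x K) = K"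
  by (simp add: digit_prefix_def)

lemma take_digit_prefix: "K \<le> L \<Longrightarrow> take K (digit_prefix b x L) = digit_prefix b x K"
  by (simp add: digit_prefix_def take_map take_upt del: upt_Suc)

lemma digit_prefix_eq_iff_digits:
  "digit_prefix b x K = digit_prefix b y K \<longleftrightarrow> (\<forall>l<K. digit b (Suc l) x = digit b (Suc l) y)"
  by (simp add: digit_prefix_def list_eq_iff_nth_eq del: upt_Suc)

lemma digit_value_less:
  assumes "\<And>k. d k < b"
  shows "digit_value b d K < b ^ K"
proof (induction K)
  case (Suc K)
  have "b * digit_value b d K + d K < b * Suc (digit_value b d K)"
    using assms[of K] by simp
  also have "\<dots> \<le> b * b ^ K"
    using Suc by (intro mult_left_mono) auto
  finally show ?case by simp
qed simp

lemma digit_value_eq_iff: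
  assumes "\<And>k. d k < b" "\<And>k. e k < b"
  shows "digit_value b d K = digit_value b e K \<longleftrightarrow> (\<forall>l<K. d l = e l)"
proof (induction K)
  case (Suc K)
  have "digit_value b d (Suc K) = digit_value b e (Suc K) \<longleftrightarrow>
      digit_value b d K = digit_value b e K \<and> d K = e K" (is "?L \<longleftrightarrow> ?R")
  proof
    assume ?L
    then have "(b * digit_value b d K + d K) div b = (b * digit_value b e K + e K) div b"
      by simp
    then have "digit_value b d K = digit_value b e K"
      using assms[of K] by simp
    with \<open>?L\<close> show ?R by simp
  qed simp
  with Suc show ?case by (auto simp: less_Suc_eq)
qed simp

locale radix =
  fixes b :: nat
  assumes base_ge_2: "2 \<le> b"
begin

lemma base_pos: "0 < b"
  using base_ge_2 by simp

lemma digit_less: "digit b k x < b"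
  using base_pos by (simp add: digit_def nat_less_iff)

lemma cell_index_nonneg_iff [simp]: "0 \<le> cell_index b K x \<longleftrightarrow> 0 \<le> x"
  using base_pos by (auto simp: cell_index_def zero_le_mult_iff power_le_zero_eq)

lemma cell_index_less_iff [simp]: "cell_index b K x < int b ^ K \<longleftrightarrow> x < 1"
  using base_pos by (simp add: cell_index_def floor_less_iff)

lemma cell_index_0_eq: "0 \<le> x \<Longrightarrow> x < 1 \<Longrightarrow> cell_index b 0 x = 0"
  by (simp add: cell_index_def floor_eq_iff)

lemma cell_index_divide_power: "cell_index b K (of_int i / real b ^ K) = i"
  using base_pos by (simp add: cell_index_def)

lemma cell_index_eq_div:
  assumes "K \<le> L"
  shows "cell_index b K x = cell_index b L x div int (b ^ (L - K))"
proof -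
  have "real b ^ L = real b ^ K * real b ^ (L - K)"
    using assms by (simp flip: power_add)
  then have "x * real b ^ L / real_of_int (int (b ^ (L - K))) = x * real b ^ K"
    using base_pos by simp
  then show ?thesis
    using floor_divide_real_eq_div[of "int (b ^ (L - K))" "x * real b ^ L"]
    by (simp add: cell_index_def)
qed

lemma cell_index_Suc: "cell_index b (Suc K) x = int b * cell_index b K x + int (digit b (Suc K) x)"
proof -
  have "cell_index b (Suc K) x div int b = cell_index b K x"
    using cell_index_eq_div[of K "Suc K" x] by simp
  moreover have "int (digit b (Suc K) x) = cell_index b (Suc K) x mod int b"
    using base_pos unfolding digit_def cell_index_def by simp
  ultimately show ?thesis
    by (metis mult_div_mod_eq)
qed

lemma digit_value_digits:
  assumes "0 \<le> x" "x < 1"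
  shows "int (digit_value b (\<lambda>k. digit b (Suc k) x) K) = cell_index b K x"
  by (induction K) (simp_all add: cell_index_Suc cell_index_0_eq[OF assms])

lemma digit_prefix_eq_iff:
  assumes "0 \<le> x" "x < 1" "0 \<le> y" "y < 1"
  shows "digit_prefix b x K = digit_prefix b y K \<longleftrightarrow> cell_index b K x = cell_index b K y"
proof -
  have "digit_prefix b x K = digit_prefix b y K \<longleftrightarrow>
      digit_value b (\<lambda>k. digit b (Suc k) x) K = digit_value b (\<lambda>k. digit b (Suc k) y) K"
    by (simp add: digit_prefix_eq_iff_digits digit_value_eq_iff digit_less)
  also have "\<dots> \<longleftrightarrow> cell_index b K x = cell_index b K y"
    using assms by (simp flip: digit_value_digits)
  finally show ?thesis .
qed

lemma ex_digit_value_eq: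
  assumes "c < b ^ K"
  shows "\<exists>e. (\<forall>k. e k < b) \<and> digit_value b e K = c"
proof (intro exI conjI allI)
  have "0 \<le> real c / real b ^ K" "real c / real b ^ K < 1"
    using assms base_pos by (simp_all flip: of_nat_power)
  then show "digit_value b (\<lambda>k. digit b (Suc k) (real c / real b ^ K)) K = c"
    using digit_value_digits[of "real c / real b ^ K" K] cell_index_divide_power[of K "int c"] by simp
qed (rule digit_less)

lemma geometric_digits_sums: "(\<lambda>k. real (b - 1) / real b ^ Suc k) sums 1"
proof -
  have "(\<lambda>k. (1 / real b) ^ k - (1 / real b) ^ Suc k) sums ((1 / real b) ^ 0 - 0)"
    using base_ge_2 by (intro telescope_sums' LIMSEQ_power_zero) simp
  moreover have "(1 / real b) ^ k - (1 / real b) ^ Suc k = real (b - 1) / real b ^ Suc k" for k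
    using base_ge_2 by (simp add: field_simps of_nat_diff)
  ultimately show ?thesis
    by simp
qed

context
  fixes d :: "nat \<Rightarrow> nat"
  assumes digits: "\<And>k. d k < b"
begin

lemma digit_term_le: "real (d k) / real b ^ Suc k \<le> real (b - 1) / real b ^ Suc k"
proof -
  have "d k \<le> b - 1"
    using digits[of k] by simp
  then show ?thesis
    by (intro divide_right_mono) (simp_all del: of_nat_diff)
qed

lemma summable_digits: "summable (\<lambda>k. real (d k) / real b ^ Suc k)"
  by (rule summable_comparison_test'[OF sums_summable[OF geometric_digits_sums], of 0])
    (use digit_term_le in simp)

lemma digit_series_nonneg: "0 \<le> digit_series b d"
  unfolding digit_series_def by (intro suminf_nonneg summable_digits) simp

lemma digit_series_less_1:
  assumes "d k \<noteq> b - 1"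
  shows "digit_series b d < 1"
proof -
  let ?gap = "\<lambda>k. real (b - 1) / real b ^ Suc k - real (d k) / real b ^ Suc k"
  have "d k < b - 1"
    using assms digits[of k] by simp
  then have "0 < ?gap k"
    using base_pos by (simp add: divide_strict_right_mono del: of_nat_diff)
  then have "0 < (\<Sum>k. ?gap k)"
    using summable_digits sums_summable[OF geometric_digits_sums] digit_term_le
    by (intro suminf_pos2[of _ k] summable_diff) simp_all
  also have "\<dots> = 1 - digit_series b d"
    using summable_digits geometric_digits_sums unfolding digit_series_def
    by (subst suminf_diff[symmetric]) (simp_all add: sums_iff)
  finally show ?thesis by simp
qed

end

lemma digit_series_mult_base:
  assumes "\<And>k. d k < b"
  shows "digit_series b d * real b = real (d 0) + digit_series b (\<lambda>k. d (Suc k))"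
proof -
  have summable: "summable (\<lambda>k. real (d (Suc k)) / real b ^ Suc k)"
    using summable_digits[of "\<lambda>k. d (Suc k)"] assms by simp
  have "digit_series b d = real (d 0) / real b + (\<Sum>k. real (d (Suc k)) / real b ^ Suc k / real b)"
    using suminf_split_head[OF summable_digits[of d, OF assms]]
    by (simp add: digit_series_def divide_divide_eq_left mult.commute mult.left_commute)
  also have "\<dots> = real (d 0) / real b + digit_series b (\<lambda>k. d (Suc k)) / real b"
    unfolding digit_series_def by (simp only: suminf_divide[OF summable])
  finally show ?thesis
    using base_pos by (simp add: field_simps)
qed

lemma digit_series_mult_power:
  assumes "\<And>k. d k < b"
  shows "digit_series b d * real b ^ K = real (digit_value b d K) + digit_series b (\<lambda>k. d (k + K))"
proof (induction K)
  case (Suc K)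
  have "digit_series b (\<lambda>k. d (k + K)) * real b = real (d K) + digit_series b (\<lambda>k. d (k + Suc K))"
    using digit_series_mult_base[of "\<lambda>k. d (k + K)"] assms by simp
  with Suc show ?case
    by (simp add: algebra_simps)
qed simp

lemma cell_index_digit_series:
  assumes "\<And>k. d k < b" "\<And>L. \<exists>k\<ge>L. d k \<noteq> b - 1"
  shows "cell_index b K (digit_series b d) = int (digit_value b d K)"
proof -
  obtain k where "K \<le> k" "d k \<noteq> b - 1"
    using assms(2) by blast
  then have "digit_series b (\<lambda>k. d (k + K)) < 1"
    using assms(1) by (intro digit_series_less_1[of _ "k - K"]) simp_all
  moreover have "0 \<le> digit_series b (\<lambda>k. d (k + K))"
    using assms(1) by (intro digit_series_nonneg)
  ultimately show ?thesis
    unfolding cell_index_def digit_series_mult_power[OF assms(1)] by (simp add: floor_unique)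
qed

end

section \<open>Elementary intervals and the uniform distribution\<close>

abbreviation unif :: "(real^'d) measure" where
  "unif \<equiv> uniform_measure lborel (box 0 One)"

definition unit_cube :: "(real^'d) set" where
  "unit_cube = {x. \<forall>j. 0 \<le> x $ j \<and> x $ j < 1}"

lemma borel_measurable_vec_nth [measurable]: "(\<lambda>x::real^'d. x $ j) \<in> borel_measurable borel"
  by (intro borel_measurable_continuous_onI continuous_intros)

lemma emeasure_lborel_half_open_box:
  fixes l u :: "'d::finite \<Rightarrow> real"
  assumes "\<And>j. l j \<le> u j"
  shows "emeasure lborel {x::real^'d. \<forall>j. l j \<le> x $ j \<and> x $ j < u j} = ennreal (\<Prod>j\<in>UNIV. u j - l j)"
    (is "emeasure lborel ?S = _")
proof -
  let ?l = "\<chi> j. l j" and ?u = "\<chi> j. u j"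
  have content: "emeasure lborel (cbox ?l ?u) = ennreal (\<Prod>j\<in>UNIV. u j - l j)"
    using content_cbox_cart[of ?l ?u] emeasure_eq_ennreal_measure[of lborel "cbox ?l ?u"]
      emeasure_lborel_cbox_finite[of ?l ?u] assms by (simp add: less_top interval_ne_empty_cart)
  show ?thesis
  proof (rule antisym)
    show "emeasure lborel ?S \<le> ennreal (\<Prod>j\<in>UNIV. u j - l j)"
      unfolding content[symmetric] by (intro emeasure_mono) (auto simp: mem_box_cart less_imp_le)
    have "emeasure lborel (box ?l ?u) = emeasure lborel (cbox ?l ?u)"
      using assms by (simp add: emeasure_lborel_box_eq emeasure_lborel_cbox_eq Basis_vec_def inner_axis)
    moreover have "emeasure lborel (box ?l ?u) \<le> emeasure lborel ?S"
      by (intro emeasure_mono) (auto simp: mem_box_cart less_imp_le)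
    ultimately show "ennreal (\<Prod>j\<in>UNIV. u j - l j) \<le> emeasure lborel ?S"
      using content by simp
  qed
qed

lemma unit_cube_sets [measurable]: "unit_cube \<in> sets borel"
  unfolding unit_cube_def by measurable

lemma emeasure_lborel_unit_box: "emeasure lborel (box 0 (One :: 'a::euclidean_space)) = 1"
  by (subst emeasure_lborel_box) (auto simp: inner_sum_left_Basis)

lemma unit_box_subset_unit_cube: "box 0 (One :: real^'d) \<subseteq> unit_cube"
proof -
  have "(One :: real^'d) $ j = 1" for j
    using inner_sum_left_Basis[of "axis j (1::real)" "\<lambda>_. 1"]
    by (simp add: axis_in_Basis_iff cart_eq_inner_axis)
  then show ?thesis
    by (auto simp: mem_box_cart unit_cube_def less_imp_le)
qed

interpretation unif: prob_space "unif :: (real^'d) measure"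
  by (rule prob_space_uniform_measure) (simp_all add: emeasure_lborel_unit_box)

lemma AE_unif_unit_box: "AE u in unif. u \<in> box 0 (One :: real^'d)"
  by (rule AE_uniform_measureI) simp_all

lemma emeasure_unif:
  assumes [measurable]: "A \<in> sets borel" and "A \<subseteq> unit_cube"
  shows "emeasure unif A = emeasure lborel (A :: (real^'d) set)"
proof -
  have "emeasure lborel (unit_cube - box 0 One :: (real^'d) set) = 0"
    using emeasure_lborel_half_open_box[of "\<lambda>_::'d. 0" "\<lambda>_. 1"] unit_box_subset_unit_cube
    by (subst emeasure_Diff) (simp_all add: emeasure_lborel_unit_box flip: unit_cube_def)
  then have "AE u in lborel. u \<notin> unit_cube - box 0 (One :: real^'d)"
    by (intro AE_not_in null_setsI) simp_all
  then have "emeasure lborel (box 0 One \<inter> A) = emeasure lborel A"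
    using assms(2) by (intro emeasure_eq_AE) auto
  then show ?thesis
    by (simp add: emeasure_lborel_unit_box divide_ennreal_def)
qed

definition elem_intervals :: "nat \<Rightarrow> nat \<Rightarrow> (real^'d) set set" where
  "elem_intervals b M = {elem_interval b \<kappa> c | \<kappa> c. (\<Sum>j\<in>UNIV. \<kappa> j) = M \<and> (\<forall>j. c j < b ^ \<kappa> j)}"

lemma finite_shapes: "finite {\<kappa> :: 'd::finite \<Rightarrow> nat. (\<Sum>j\<in>UNIV. \<kappa> j) = M}"
  and card_shapes_le: "card {\<kappa> :: 'd::finite \<Rightarrow> nat. (\<Sum>j\<in>UNIV. \<kappa> j) = M} \<le> (M + 1) ^ CARD('d)"
proof -
  let ?X = "PiE (UNIV :: 'd set) (\<lambda>_. {..M})"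
  have fin: "finite ?X"
    by (intro finite_PiE) auto
  have sub: "{\<kappa> :: 'd \<Rightarrow> nat. (\<Sum>j\<in>UNIV. \<kappa> j) = M} \<subseteq> ?X"
    by (auto simp: PiE_UNIV_domain intro: member_le_sum)
  then show "finite {\<kappa> :: 'd \<Rightarrow> nat. (\<Sum>j\<in>UNIV. \<kappa> j) = M}"
    using fin by (rule finite_subset)
  show "card {\<kappa> :: 'd \<Rightarrow> nat. (\<Sum>j\<in>UNIV. \<kappa> j) = M} \<le> (M + 1) ^ CARD('d)"
    using card_mono[OF fin sub] by (simp add: card_PiE)
qed

lemma finite_elem_intervals: "finite (elem_intervals b M :: (real^'d) set set)"
proof -
  have "elem_intervals b M = (\<lambda>(\<kappa>, c). elem_interval b \<kappa> c) `
      (SIGMA \<kappa>:{\<kappa> :: 'd \<Rightarrow> nat. (\<Sum>j\<in>UNIV. \<kappa> j) = M}. PiE UNIV (\<lambda>j. {..<b ^ \<kappa> j}))"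
    by (force simp: elem_intervals_def PiE_UNIV_domain)
  then show ?thesis
    by (simp add: finite_SigmaI finite_shapes finite_PiE)
qed

definition grid_cell :: "nat \<Rightarrow> nat \<Rightarrow> ('d \<Rightarrow> int) \<Rightarrow> (real^'d) set" where
  "grid_cell b K c = {x. \<forall>j. cell_index b K (x $ j) = c j}"

lemma grid_cell_sets [measurable]: "grid_cell b K c \<in> sets borel"
  unfolding grid_cell_def cell_index_def by measurable

definition grid_cells :: "nat \<Rightarrow> (real^'d) set set" where
  "grid_cells b = insert {} (range (\<lambda>(K, c). grid_cell b K c))"

context radix
begin

lemma unit_cube_altdef: "x \<in> unit_cube \<longleftrightarrow> (\<forall>j. cell_index b (\<kappa> j) (x $ j) \<in> {0..<int b ^ \<kappa> j})"
  by (simp add: unit_cube_def)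

lemma mem_elem_interval_iff: "x \<in> elem_interval b \<kappa> c \<longleftrightarrow> (\<forall>j. cell_index b (\<kappa> j) (x $ j) = int (c j))"
  using base_pos unfolding elem_interval_def cell_index_def by (simp add: floor_eq_iff field_simps)

lemma elem_interval_sets [measurable]: "elem_interval b \<kappa> c \<in> sets borel"
  unfolding elem_interval_def by measurable

lemma elem_interval_subset_unit_cube:
  assumes "\<And>j. c j < b ^ \<kappa> j"
  shows "elem_interval b \<kappa> c \<subseteq> unit_cube"
  using assms by (auto simp: unit_cube_altdef[of _ \<kappa>] mem_elem_interval_iff simp flip: of_nat_power)

lemma emeasure_unif_elem_interval:
  fixes \<kappa> :: "'d::finite \<Rightarrow> nat"
  assumes "\<And>j. c j < b ^ \<kappa> j"
  shows "emeasure unif (elem_interval b \<kappa> c) = ennreal (1 / real b ^ (\<Sum>j\<in>UNIV. \<kappa> j))"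
proof -
  have "emeasure unif (elem_interval b \<kappa> c) = emeasure lborel (elem_interval b \<kappa> c)"
    using assms by (intro emeasure_unif elem_interval_subset_unit_cube) auto
  also have "\<dots> = ennreal (\<Prod>j\<in>UNIV. real (c j + 1) / real b ^ \<kappa> j - real (c j) / real b ^ \<kappa> j)"
    unfolding elem_interval_def by (intro emeasure_lborel_half_open_box divide_right_mono) simp_all
  also have "\<dots> = ennreal (1 / real b ^ (\<Sum>j\<in>UNIV. \<kappa> j))"
    by (simp add: diff_divide_distrib[symmetric] power_sum prod_dividef)
  finally show ?thesis .
qed

lemma elem_intervals_sets [measurable_dest]: "I \<in> elem_intervals b M \<Longrightarrow> I \<in> sets borel"
  by (auto simp: elem_intervals_def)

lemma measure_unif_elem_intervals:
  assumes "I \<in> elem_intervals b M"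
  shows "measure unif I = 1 / real b ^ M"
  using assms by (auto simp: elem_intervals_def measure_def emeasure_unif_elem_interval
      simp del: emeasure_uniform_measure)

lemma grid_cell_Int:
  assumes "K \<le> L"
  shows "grid_cell b K c \<inter> grid_cell b L c' \<in> {{}, grid_cell b L c'}"
  by (auto simp: grid_cell_def cell_index_eq_div[OF assms])

lemma Int_stable_grid_cells: "Int_stable (grid_cells b :: (real^'d) set set)"
proof (rule Int_stableI)
  have Int: "grid_cell b K c \<inter> grid_cell b L c' \<in> grid_cells b" for K L and c c' :: "'d \<Rightarrow> int"
  proof (induction K L arbitrary: c c' rule: linorder_wlog)
    case (le K L)
    then show ?case
      using grid_cell_Int[OF le, of c c'] by (force simp: grid_cells_def)
  next
    case (sym K L)
    then show ?case
      by (metis Int_commute)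
  qed
  fix A B :: "(real^'d) set"
  assume cells: "A \<in> grid_cells b" "B \<in> grid_cells b"
  show "A \<inter> B \<in> grid_cells b"
  proof (cases "A = {} \<or> B = {}")
    case True
    then show ?thesis
      by (auto simp: grid_cells_def)
  next
    case False
    with cells obtain K c L c' where "A = grid_cell b K c" "B = grid_cell b L c'"
      by (auto simp: grid_cells_def)
    then show ?thesis
      by (simp add: Int)
  qed
qed

lemma ex_grid_cell_subset_ball:
  fixes z :: "real^'d"
  assumes "0 < e"
  shows "\<exists>K. grid_cell b K (\<lambda>j. cell_index b K (z $ j)) \<subseteq> ball z e"
proof -
  obtain K where K: "(1 / real b) ^ K < e / real CARD('d)"
    using real_arch_pow_inv[of "e / real CARD('d)" "1 / real b"] assms base_ge_2 by auto
  have "y \<in> ball z e" if y: "y \<in> grid_cell b K (\<lambda>j. cell_index b K (z $ j))" for y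
  proof -
    have "\<bar>(z - y) $ j\<bar> \<le> (1 / real b) ^ K" for j
    proof -
      have "\<lfloor>z $ j * real b ^ K\<rfloor> = \<lfloor>y $ j * real b ^ K\<rfloor>"
        using y by (simp add: grid_cell_def cell_index_def)
      then have "\<bar>z $ j * real b ^ K - y $ j * real b ^ K\<bar> \<le> 1"
        by linarith
      then have "\<bar>(z - y) $ j\<bar> * real b ^ K \<le> 1"
        by (simp add: abs_mult flip: left_diff_distrib)
      then show ?thesis
        using base_pos by (simp add: power_divide pos_le_divide_eq)
    qed
    then have "norm (z - y) \<le> real CARD('d) * (1 / real b) ^ K"
      using norm_le_l1_cart[of "z - y"]
        sum_bounded_above[of UNIV "\<lambda>j. \<bar>(z - y) $ j\<bar>" "(1 / real b) ^ K"] by simp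
    with K show ?thesis
      by (simp add: dist_norm pos_less_divide_eq mult.commute)
  qed
  then show ?thesis
    by blast
qed

lemma sets_borel_eq_grid_cells: "sets (borel :: (real^'d) measure) = sigma_sets UNIV (grid_cells b)"
proof -
  have "sigma_sets UNIV {S :: (real^'d) set. open S} = sigma_sets UNIV (grid_cells b)"
  proof (rule sigma_sets_eqI)
    fix S :: "(real^'d) set" assume "S \<in> {S. open S}"
    then have S: "open S" by simp
    have "\<exists>K. grid_cell b K (\<lambda>j. cell_index b K (z $ j)) \<subseteq> S" if "z \<in> S" for z
      using S that ex_grid_cell_subset_ball[of _ z] by (meson open_contains_ball order_trans)
    then have "S = (\<Union>(K, c)\<in>{(K, c). grid_cell b K c \<subseteq> S}. grid_cell b K c)"
      by (fastforce simp: grid_cell_def)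
    also have "\<dots> \<in> sigma_sets UNIV (grid_cells b)"
      by (intro sigma_sets_UNION) (auto simp: grid_cells_def intro: sigma_sets.Basic)
    finally show "S \<in> sigma_sets UNIV (grid_cells b)" .
  next
    fix S :: "(real^'d) set" assume "S \<in> grid_cells b"
    then have "S \<in> sets borel"
      by (auto simp: grid_cells_def)
    then show "S \<in> sigma_sets UNIV {S. open S}"
      by (simp add: borel_def)
  qed
  then show ?thesis
    by (simp add: borel_def)
qed

lemma measure_eqI_elem_intervals:
  fixes M N :: "(real^'d) measure"
  assumes "finite_measure M" "sets M = sets borel" "sets N = sets borel"
    and null: "emeasure M (- unit_cube) = 0" "emeasure N (- unit_cube) = 0"
    and eq: "\<And>K c. (\<And>j. c j < b ^ K) \<Longrightarrow>
      emeasure M (elem_interval b (\<lambda>_. K) c) = emeasure N (elem_interval b (\<lambda>_. K) c)"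
  shows "M = N"
proof (rule measure_eqI_generator_eq[OF Int_stable_grid_cells])
  interpret finite_measure M by fact
  fix A :: "(real^'d) set" assume "A \<in> grid_cells b"
  then consider (empty) "A = {}" | (cell) K c where "A = grid_cell b K c"
    by (auto simp: grid_cells_def)
  then show "emeasure M A = emeasure N A"
  proof cases
    case cell
    show ?thesis
    proof (cases "\<forall>j. 0 \<le> c j \<and> c j < int b ^ K")
      case True
      then have "A = elem_interval b (\<lambda>_. K) (\<lambda>j. nat (c j))"
        unfolding cell by (auto simp: grid_cell_def mem_elem_interval_iff)
      with True show ?thesis
        by (simp add: eq nat_less_iff)
    next
      case False
      then have "A \<subseteq> - unit_cube"
        unfolding cell by (auto simp: grid_cell_def unit_cube_altdef[of _ "\<lambda>_. K"])
      then show ?thesis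
        using emeasure_eq_0[of "- unit_cube" M A] emeasure_eq_0[of "- unit_cube" N A] null assms(2,3)
        by simp
    qed
  qed simp
next
  let ?cell = "\<lambda>i. grid_cell b 0 (from_nat i) :: (real^'d) set"
  show "range ?cell \<subseteq> grid_cells b"
    by (auto simp: grid_cells_def)
  have "x \<in> ?cell (to_nat (\<lambda>j. cell_index b 0 (x $ j)))" for x
    by (simp add: grid_cell_def)
  then show "(\<Union>i. ?cell i) = UNIV"
    by blast
qed (use assms(1-3) sets_borel_eq_grid_cells in \<open>auto simp: finite_measure.emeasure_finite\<close>)

end

section \<open>Nested uniform scrambling\<close>

definition scrambled_digit :: "nat \<Rightarrow> ('d \<times> nat list \<Rightarrow> nat \<Rightarrow> nat) \<Rightarrow> 'd \<Rightarrow> real \<Rightarrow> nat \<Rightarrow> nat" where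
  "scrambled_digit b \<pi> j x k = \<pi> (j, digit_prefix b x k) (digit b (Suc k) x)"

lemma scramble_nth: "scramble b \<pi> u $ j = digit_series b (scrambled_digit b \<pi> j (u $ j))"
  by (simp add: scramble_def scramble_coord_def digit_series_def scrambled_digit_def digit_prefix_def)

text \<open>A scrambled expansion that ends in \<open>b - 1\<close> throughout is not the standard expansion of
  its value, so such permutations have to be discarded.\<close>

definition regular_scrambling :: "nat \<Rightarrow> ('d \<times> nat list \<Rightarrow> nat \<Rightarrow> nat) \<Rightarrow> real^'d \<Rightarrow> bool" where
  "regular_scrambling b \<pi> x \<longleftrightarrow> (\<forall>i. \<pi> i permutes {..<b}) \<and>
     (\<forall>j L. \<exists>k\<ge>L. scrambled_digit b \<pi> j (x $ j) k \<noteq> b - 1)"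

lemma regular_scrambling_permutes: "regular_scrambling b \<pi> x \<Longrightarrow> \<pi> i permutes {..<b}"
  unfolding regular_scrambling_def by blast

definition digit_cylinder ::
    "nat \<Rightarrow> real^'d \<Rightarrow> ('d \<times> nat) set \<Rightarrow> ('d \<Rightarrow> nat \<Rightarrow> nat) \<Rightarrow> ('d \<times> nat list \<Rightarrow> nat \<Rightarrow> nat) set" where
  "digit_cylinder b x F e = {\<pi>. \<forall>(j, l)\<in>F. scrambled_digit b \<pi> j (x $ j) l = e j l}"

abbreviation leading_digits :: "('d \<Rightarrow> nat) \<Rightarrow> ('d \<times> nat) set" where
  "leading_digits \<kappa> \<equiv> SIGMA j:UNIV. {..<\<kappa> j}"

context radix
begin

lemma scrambled_digit_less:
  assumes "\<And>i. \<pi> i permutes {..<b}"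
  shows "scrambled_digit b \<pi> j x k < b"
  using permutes_in_image[OF assms, of _ "digit b (Suc k) x"] digit_less[of "Suc k" x]
  by (simp add: scrambled_digit_def)

lemma scrambled_digits_eq_iff:
  assumes "\<And>i. \<pi> i permutes {..<b}" "0 \<le> x" "x < 1" "0 \<le> y" "y < 1"
  shows "(\<forall>l<K. scrambled_digit b \<pi> j x l = scrambled_digit b \<pi> j y l) \<longleftrightarrow>
    cell_index b K x = cell_index b K y"
proof -
  have "(\<forall>l<K. scrambled_digit b \<pi> j x l = scrambled_digit b \<pi> j y l) \<longleftrightarrow>
      digit_prefix b x K = digit_prefix b y K"
  proof (induction K)
    case (Suc K)
    have "scrambled_digit b \<pi> j x K = scrambled_digit b \<pi> j y K \<longleftrightarrow> digit b (Suc K) x = digit b (Suc K) y"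
      if "digit_prefix b x K = digit_prefix b y K"
      using that permutes_inj[OF assms(1)] by (auto simp: scrambled_digit_def inj_eq)
    with Suc show ?case
      by (auto simp: less_Suc_eq digit_prefix_eq_iff_digits)
  qed (simp add: digit_prefix_def)
  then show ?thesis
    by (simp add: digit_prefix_eq_iff[OF assms(2-)])
qed

lemma cell_index_scramble:
  assumes "regular_scrambling b \<pi> x"
  shows "cell_index b K (scramble b \<pi> x $ j) = int (digit_value b (scrambled_digit b \<pi> j (x $ j)) K)"
  unfolding scramble_nth
  using assms
  by (intro cell_index_digit_series scrambled_digit_less) (auto simp: regular_scrambling_def)

lemma scramble_mem_unit_cube:
  assumes "regular_scrambling b \<pi> x"
  shows "scramble b \<pi> x \<in> unit_cube"
  using cell_index_scramble[OF assms, of 0] by (simp add: unit_cube_altdef[of _ "\<lambda>_. 0"])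

lemma scramble_mem_elem_interval_iff:
  assumes "regular_scrambling b \<pi> x" "\<And>j k. e j k < b"
  shows "scramble b \<pi> x \<in> elem_interval b \<kappa> (\<lambda>j. digit_value b (e j) (\<kappa> j)) \<longleftrightarrow>
    \<pi> \<in> digit_cylinder b x (leading_digits \<kappa>) e"
proof -
  have "scrambled_digit b \<pi> j (x $ j) k < b" for j k
    using assms(1) by (intro scrambled_digit_less regular_scrambling_permutes)
  then show ?thesis
    using assms
    by (auto simp: mem_elem_interval_iff cell_index_scramble digit_value_eq_iff digit_cylinder_def)
qed

lemma ex_cell_index_of_scrambled_digits:
  assumes perm: "\<And>i. \<pi> i permutes {..<b}" and "c < b ^ K"
  shows "\<exists>c'<b ^ K. \<forall>x. 0 \<le> x \<longrightarrow> x < 1 \<longrightarrow>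
    (digit_value b (scrambled_digit b \<pi> j x) K = c \<longleftrightarrow> cell_index b K x = int c')"
proof -
  define f where "f a = digit_value b (scrambled_digit b \<pi> j (real a / real b ^ K)) K" for a
  have less: "scrambled_digit b \<pi> j y k < b" for y k
    by (rule scrambled_digit_less[OF perm])
  have f_eq_iff: "digit_value b (scrambled_digit b \<pi> j x) K = f a \<longleftrightarrow> cell_index b K x = int a"
    if "0 \<le> x" "x < 1" "a < b ^ K" for x a
  proof -
    have "0 \<le> real a / real b ^ K" "real a / real b ^ K < 1"
      using that(3) base_pos by (simp_all flip: of_nat_power)
    then show ?thesis
      using scrambled_digits_eq_iff[where \<pi>=\<pi> and j=j and y="real a / real b ^ K", OF perm that(1,2)]
        cell_index_divide_power[of K "int a"]
      by (simp add: f_def digit_value_eq_iff less)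
  qed
  have "inj_on f {..<b ^ K}"
  proof (rule inj_onI)
    fix p q assume pq: "p \<in> {..<b ^ K}" "q \<in> {..<b ^ K}" "f p = f q"
    then have "cell_index b K (real p / real b ^ K) = int q"
      using f_eq_iff[of "real p / real b ^ K" q] base_pos by (simp add: f_def flip: of_nat_power)
    then show "p = q"
      using cell_index_divide_power[of K "int p"] by simp
  qed
  moreover have "f ` {..<b ^ K} \<subseteq> {..<b ^ K}"
    using digit_value_less[OF less] by (auto simp: f_def)
  ultimately have "c \<in> f ` {..<b ^ K}"
    using assms(2) by (simp add: endo_inj_surj)
  then show ?thesis
    using f_eq_iff by auto
qed

lemma is_net_scramble:
  fixes x :: "nat \<Rightarrow> real^'d"
  assumes net: "is_net b t m x" and reg: "\<And>i. i < b ^ m \<Longrightarrow> regular_scrambling b \<pi> (x i)"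
  shows "is_net b t m (\<lambda>i. scramble b \<pi> (x i))"
  unfolding is_net_def
proof (intro conjI allI impI)
  show "t \<le> m"
    using net by (simp add: is_net_def)
  fix i j assume "i < b ^ m"
  then show "0 \<le> scramble b \<pi> (x i) $ j" "scramble b \<pi> (x i) $ j < 1"
    using scramble_mem_unit_cube[OF reg] by (simp_all add: unit_cube_def)
next
  fix \<kappa> c :: "'d \<Rightarrow> nat"
  assume \<kappa>: "(\<Sum>j\<in>UNIV. \<kappa> j) = m - t" and c: "\<forall>j. c j < b ^ \<kappa> j"
  have perm: "\<pi> i permutes {..<b}" for i
    using reg[of 0] base_pos by (simp add: regular_scrambling_permutes)
  have "\<exists>c'<b ^ \<kappa> j. \<forall>y. 0 \<le> y \<longrightarrow> y < 1 \<longrightarrow>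
      (digit_value b (scrambled_digit b \<pi> j y) (\<kappa> j) = c j \<longleftrightarrow> cell_index b (\<kappa> j) y = int c')" for j
    using ex_cell_index_of_scrambled_digits[where \<pi>=\<pi>, OF perm] c by simp
  then obtain c' where c': "\<And>j. c' j < b ^ \<kappa> j"
    "\<And>j y. 0 \<le> y \<Longrightarrow> y < 1 \<Longrightarrow>
      digit_value b (scrambled_digit b \<pi> j y) (\<kappa> j) = c j \<longleftrightarrow> cell_index b (\<kappa> j) y = int (c' j)"
    by metis
  have "scramble b \<pi> (x i) \<in> elem_interval b \<kappa> c \<longleftrightarrow> x i \<in> elem_interval b \<kappa> c'" if "i < b ^ m" for i
    using net that by (simp add: mem_elem_interval_iff cell_index_scramble[OF reg] c'(2) is_net_def)
  then have "{i\<in>{..<b ^ m}. scramble b \<pi> (x i) \<in> elem_interval b \<kappa> c} =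
      {i\<in>{..<b ^ m}. x i \<in> elem_interval b \<kappa> c'}"
    by auto
  then show "card {i\<in>{..<b ^ m}. scramble b \<pi> (x i) \<in> elem_interval b \<kappa> c} = b ^ t"
    using net \<kappa> c'(1) by (simp add: is_net_def)
qed

end

section \<open>Uniform random permutations\<close>

lemma prob_uniform_permutation_apply:
  assumes "finite A" "a \<in> A" "c \<in> A"
  shows "measure_pmf.prob (pmf_of_set {p. p permutes A}) {p. p a = c} = 1 / real (card A)"
proof -
  let ?T = "\<lambda>p. Transposition.transpose a c \<circ> p"
  have T: "Transposition.transpose a c permutes A"
    using assms by (intro permutes_swap_id)
  have "bij_betw ?T {p. p permutes (A - {a})} {p. p permutes A \<and> p a = c}"
  proof (rule bij_betw_byWitness[of _ ?T])
    show "?T ` {p. p permutes (A - {a})} \<subseteq> {p. p permutes A \<and> p a = c}"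
      using permutes_not_in by (fastforce intro: permutes_compose[OF _ T] permutes_subset)
    show "?T ` {p. p permutes A \<and> p a = c} \<subseteq> {p. p permutes (A - {a})}"
      using permutes_superset[OF permutes_compose[OF _ T]] by fastforce
  qed (auto simp flip: o_assoc)
  then have "card {p. p permutes A \<and> p a = c} = fact (card A - 1)"
    using assms card_permutations[of "A - {a}"] by (auto dest: bij_betw_same_card)
  moreover have "fact (card A) = real (card A) * fact (card A - 1)"
    using assms by (intro fact_reduce) (auto simp: card_gt_0_iff)
  moreover have "{p. p permutes A} \<noteq> {}"
    using permutes_id by blast
  ultimately show ?thesis
    using assms card_permutations[OF refl assms(1)]
    by (simp add: measure_pmf_of_set finite_permutations Collect_conj_eq[symmetric] del: fact_Suc)
qed

abbreviation perm_pmf :: "nat \<Rightarrow> (nat \<Rightarrow> nat) pmf" where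
  "perm_pmf b \<equiv> pmf_of_set {p. p permutes {..<b}}"

lemma set_perm_pmf: "set_pmf (perm_pmf b) = {p. p permutes {..<b}}"
  by (rule set_pmf_of_set) (auto intro: finite_permutations permutes_id)

interpretation perm_pmfs: product_prob_space "\<lambda>_. measure_pmf (perm_pmf b)" UNIV for b
  by unfold_locales

interpretation perm_space: prob_space "perm_space b" for b
  unfolding perm_space_def by (intro prob_space_PiM measure_pmf.prob_space_axioms)

lemma space_perm_space [simp]: "space (perm_space b) = UNIV"
  by (simp add: perm_space_def space_PiM)

lemma measurable_scrambled_digit [measurable]:
  "(\<lambda>\<pi>. scrambled_digit b \<pi> j x k) \<in> measurable (perm_space b) (count_space UNIV)"
proof -
  have "(\<lambda>\<pi>. \<pi> i) \<in> measurable (perm_space b) (measure_pmf (perm_pmf b))" for i :: "'d \<times> nat list"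
    unfolding perm_space_def by (rule measurable_component_singleton) simp
  then show ?thesis
    unfolding scrambled_digit_def by (rule measurable_compose) simp
qed

lemma measurable_scramble [measurable]:
  fixes x :: "real^'d"
  shows "(\<lambda>\<pi>. scramble b \<pi> x) \<in> borel_measurable (perm_space b)"
proof (rule borel_measurable_euclidean_space[THEN iffD2], rule ballI)
  fix i :: "real^'d" assume "i \<in> Basis"
  then obtain j where "i = axis j 1"
    by (auto simp: Basis_vec_def)
  then have "(\<lambda>\<pi>. scramble b \<pi> x \<bullet> i) = (\<lambda>\<pi>. digit_series b (scrambled_digit b \<pi> j (x $ j)))"
    by (simp add: inner_axis scramble_nth)
  also have "\<dots> \<in> borel_measurable (perm_space b)"
    unfolding digit_series_def by measurable
  finally show "(\<lambda>\<pi>. scramble b \<pi> x \<bullet> i) \<in> borel_measurable (perm_space b)" .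
qed

lemma digit_cylinder_sets:
  assumes "finite F"
  shows "digit_cylinder b x F e \<in> sets (perm_space b)"
proof -
  have "{\<pi> \<in> space (perm_space b).
      \<forall>p\<in>F. scrambled_digit b \<pi> (fst p) (x $ fst p) (snd p) = e (fst p) (snd p)} \<in> sets (perm_space b)"
    using assms by measurable
  then show ?thesis
    by (simp add: digit_cylinder_def case_prod_beta)
qed

lemma AE_perm_space_permutes: "AE \<pi> in perm_space b. \<forall>i::'d::finite \<times> nat list. \<pi> i permutes {..<b}"
proof -
  have "AE \<pi> in perm_space b. \<pi> i permutes {..<b}" for i :: "'d \<times> nat list"
    unfolding perm_space_def
    by (rule perm_pmfs.AE_component) (simp_all add: AE_measure_pmf_iff set_perm_pmf)
  then show ?thesis
    by (simp add: AE_all_countable)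
qed

context radix
begin

lemma prob_digit_cylinder:
  fixes x :: "real^'d"
  assumes "finite F" "\<And>j l. e j l < b"
  shows "measure (perm_space b) (digit_cylinder b x F e) = 1 / real b ^ card F"
proof -
  define idx where "idx = (\<lambda>(j, l). (j, digit_prefix b (x $ j) l))"
  have inj: "inj idx"
    unfolding idx_def by (rule injI) (auto dest: arg_cong[of _ _ length])
  define X where "X = (\<lambda>(j, p::nat list). {q. q (digit b (Suc (length p)) (x $ j)) = e j (length p)})"
  have "digit_cylinder b x F e =
      {\<pi> \<in> space (PiM UNIV (\<lambda>_. measure_pmf (perm_pmf b))). \<forall>i\<in>idx ` F. \<pi> i \<in> X i}"
    by (auto simp: digit_cylinder_def space_PiM idx_def X_def scrambled_digit_def)
  then have "emeasure (perm_space b) (digit_cylinder b x F e) =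
      (\<Prod>i\<in>idx ` F. emeasure (perm_pmf b) (X i))"
    using assms(1) unfolding perm_space_def
    by (simp only:) (rule perm_pmfs.emeasure_PiM_Collect, simp_all)
  also have "\<dots> = (\<Prod>i\<in>idx ` F. ennreal (1 / real b))"
    using assms(2) by (intro prod.cong refl)
      (auto simp: idx_def X_def measure_pmf.emeasure_eq_measure prob_uniform_permutation_apply
        digit_less)
  also have "\<dots> = ennreal (1 / real b ^ card F)"
    by (simp add: card_image inj_on_subset[OF inj] ennreal_power power_divide)
  finally show ?thesis
    by (simp add: measure_def)
qed

lemma AE_regular_scrambling:
  fixes x :: "real^'d"
  shows "AE \<pi> in perm_space b. regular_scrambling b \<pi> x"
proof -
  have "AE \<pi> in perm_space b. \<exists>k\<ge>L. scrambled_digit b \<pi> j (x $ j) k \<noteq> b - 1" for j L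
  proof -
    let ?N = "{\<pi>. \<forall>k\<ge>L. scrambled_digit b \<pi> j (x $ j) k = b - 1}"
    have N_sets: "{\<pi> \<in> space (perm_space b). \<forall>k\<ge>L. scrambled_digit b \<pi> j (x $ j) k = b - 1}
        \<in> sets (perm_space b)"
      by measurable
    have "measure (perm_space b) ?N \<le> (1 / real b) ^ n" for n
    proof -
      let ?F = "{j} \<times> {L..<L + n}"
      have "measure (perm_space b) ?N \<le> measure (perm_space b) (digit_cylinder b x ?F (\<lambda>_ _. b - 1))"
        by (intro perm_space.finite_measure_mono digit_cylinder_sets) (auto simp: digit_cylinder_def)
      also have "\<dots> = (1 / real b) ^ n"
        using base_pos by (simp add: prob_digit_cylinder power_divide card_cartesian_product)
      finally show ?thesis .
    qed
    moreover have "(\<lambda>n. (1 / real b) ^ n) \<longlonglongrightarrow> 0"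
      using base_ge_2 by (intro LIMSEQ_power_zero) simp
    ultimately have "measure (perm_space b) ?N \<le> 0"
      by (intro LIMSEQ_le_const) auto
    then have "perm_space.prob b ?N = 0"
      by (simp add: measure_le_0_iff)
    with N_sets show ?thesis
      using perm_space.prob_eq_0[of ?N b] by simp
  qed
  then have "AE \<pi> in perm_space b. \<forall>j L. \<exists>k\<ge>L. scrambled_digit b \<pi> j (x $ j) k \<noteq> b - 1"
    by (simp add: AE_all_countable AE_finite_all[of UNIV, simplified])
  with AE_perm_space_permutes show ?thesis
    unfolding regular_scrambling_def by eventually_elim auto
qed

lemma distr_scramble:
  fixes x :: "real^'d"
  shows "distr (perm_space b) borel (\<lambda>\<pi>. scramble b \<pi> x) = unif" (is "?D = _")
proof (rule measure_eqI_elem_intervals)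
  interpret D: prob_space ?D
    by (rule perm_space.prob_space_distr) simp
  show "finite_measure ?D"
    by unfold_locales
  have "AE u in ?D. u \<in> unit_cube"
    using AE_regular_scrambling[of x] by (subst AE_distr_iff) (auto intro: scramble_mem_unit_cube)
  then show "emeasure ?D (- unit_cube) = 0"
    by (subst AE_iff_measurable[symmetric]) (auto simp: Compl_eq)
  have "emeasure unif (- unit_cube :: (real^'d) set) =
      emeasure lborel (box 0 One \<inter> - unit_cube :: (real^'d) set)"
    by (simp add: emeasure_lborel_unit_box divide_ennreal_def)
  also have "box 0 One \<inter> - unit_cube = ({} :: (real^'d) set)"
    using unit_box_subset_unit_cube by blast
  finally show "emeasure unif (- unit_cube :: (real^'d) set) = 0"
    by simp
next
  fix K :: nat and c :: "'d \<Rightarrow> nat" assume c: "\<And>j. c j < b ^ K"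
  then obtain e where e: "\<And>j k. e j k < b" "\<And>j. digit_value b (e j) K = c j"
    using ex_digit_value_eq[OF c] by metis
  let ?F = "leading_digits (\<lambda>_::'d. K)"
  have "emeasure ?D (elem_interval b (\<lambda>_. K) c) =
      emeasure (perm_space b) ((\<lambda>\<pi>. scramble b \<pi> x) -` elem_interval b (\<lambda>_. K) c)"
    by (simp add: emeasure_distr)
  also have "\<dots> = emeasure (perm_space b) (digit_cylinder b x ?F e)"
  proof (rule emeasure_eq_AE)
    show "AE \<pi> in perm_space b. \<pi> \<in> (\<lambda>\<pi>. scramble b \<pi> x) -` elem_interval b (\<lambda>_. K) c \<longleftrightarrow>
        \<pi> \<in> digit_cylinder b x ?F e"
      using AE_regular_scrambling[of x]
      by eventually_elim
        (use scramble_mem_elem_interval_iff[where \<kappa>="\<lambda>_. K" and e=e, OF _ e(1)] e(2) in simp)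
    show "(\<lambda>\<pi>. scramble b \<pi> x) -` elem_interval b (\<lambda>_. K) c \<in> sets (perm_space b)"
      using measurable_sets[OF measurable_scramble elem_interval_sets, of b x] by simp
  qed (simp add: digit_cylinder_sets)
  also have "\<dots> = ennreal (1 / real b ^ (\<Sum>j\<in>(UNIV :: 'd set). K))"
    using e(1) by (simp add: perm_space.emeasure_eq_measure prob_digit_cylinder card_SigmaI)
  also have "\<dots> = emeasure unif (elem_interval b (\<lambda>_. K) c)"
    by (rule emeasure_unif_elem_interval[OF c, symmetric])
  finally show "emeasure ?D (elem_interval b (\<lambda>_. K) c) = emeasure unif (elem_interval b (\<lambda>_. K) c)" .
qed simp_all

lemma AE_scramble:
  assumes "AE u in unif. Q u" "{u. Q u} \<in> sets borel"
  shows "AE \<pi> in perm_space b. Q (scramble b \<pi> x)"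
  using assms unfolding distr_scramble[symmetric, of x] by (subst (asm) AE_distr_iff) auto

lemma integral_scramble:
  fixes h :: "real^'d \<Rightarrow> real"
  assumes "h \<in> borel_measurable borel"
  shows "(\<integral>\<pi>. h (scramble b \<pi> x) \<partial>perm_space b) = (\<integral>u. h u \<partial>unif)"
  unfolding distr_scramble[symmetric, of x] using assms by (subst integral_distr) auto

lemma integrable_scramble_iff:
  fixes h :: "real^'d \<Rightarrow> real"
  assumes "h \<in> borel_measurable borel"
  shows "integrable (perm_space b) (\<lambda>\<pi>. h (scramble b \<pi> x)) \<longleftrightarrow> integrable unif h"
  unfolding distr_scramble[symmetric, of x] using assms by (simp add: integrable_distr_eq)

end

section \<open>Square integrable functions\<close>

definition square_integrable :: "'a measure \<Rightarrow> ('a \<Rightarrow> real) \<Rightarrow> bool" where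
  "square_integrable M f \<longleftrightarrow> f \<in> borel_measurable M \<and> integrable M (\<lambda>x. (f x)\<^sup>2)"

lemma square_integrable_measurable [measurable_dest]:
  "square_integrable M f \<Longrightarrow> f \<in> borel_measurable M"
  by (simp add: square_integrable_def)

lemma square_integrable_mult:
  assumes f: "square_integrable M f" and g: "square_integrable M g"
  shows "integrable M (\<lambda>x. f x * g x)"
proof (rule Bochner_Integration.integrable_bound)
  show "integrable M (\<lambda>x. ((f x)\<^sup>2 + (g x)\<^sup>2) / 2)"
    using f g by (simp add: square_integrable_def)
  show "AE x in M. norm (f x * g x) \<le> norm (((f x)\<^sup>2 + (g x)\<^sup>2) / 2)"
  proof (rule AE_I2)
    fix x
    show "norm (f x * g x) \<le> norm (((f x)\<^sup>2 + (g x)\<^sup>2) / 2)"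
      using sum_squares_bound[of "\<bar>f x\<bar>" "\<bar>g x\<bar>"] by (simp add: abs_mult)
  qed
qed (use f g in measurable)

lemma square_integrable_cmult: "square_integrable M f \<Longrightarrow> square_integrable M (\<lambda>x. c * f x)"
  by (auto simp: square_integrable_def power_mult_distrib)

lemma square_integrable_add:
  assumes "square_integrable M f" "square_integrable M g"
  shows "square_integrable M (\<lambda>x. f x + g x)"
  using assms square_integrable_mult[OF assms]
  by (auto simp: square_integrable_def power2_sum mult.assoc)

lemma square_integrable_diff:
  assumes "square_integrable M f" "square_integrable M g"
  shows "square_integrable M (\<lambda>x. f x - g x)"
  using square_integrable_add[OF assms(1) square_integrable_cmult[OF assms(2), of "-1"]] by simp

lemma square_integrable_sum:
  assumes "\<And>s. s \<in> S \<Longrightarrow> square_integrable M (f s)"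
  shows "square_integrable M (\<lambda>x. \<Sum>s\<in>S. f s x)"
  using assms
proof (induction S rule: infinite_finite_induct)
  case (insert s S)
  then show ?case
    using square_integrable_add[of M "f s"] by simp
qed (simp_all add: square_integrable_def)

lemma (in finite_measure) square_integrable_indicator:
  "A \<in> sets M \<Longrightarrow> square_integrable M (indicator A)"
  by (simp add: square_integrable_def power2_eq_square emeasure_eq_measure
      flip: indicator_inter_arith)

lemma (in finite_measure) integrable_if_square_integrable:
  "square_integrable M f \<Longrightarrow> integrable M f"
  by (auto simp: square_integrable_def intro: square_integrable_imp_integrable)

lemma integral_diff_cmult_mult:
  assumes "square_integrable M f" "square_integrable M g" "square_integrable M k"
  shows "(\<integral>x. (f x - a * g x) * k x \<partial>M) = (\<integral>x. f x * k x \<partial>M) - a * (\<integral>x. g x * k x \<partial>M)"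
  using assms by (simp add: left_diff_distrib mult.assoc square_integrable_mult)

lemma integral_mult_linear_combination:
  assumes "square_integrable M h" "\<And>s. s \<in> S \<Longrightarrow> square_integrable M (e s)"
  shows "(\<integral>x. h x * (\<Sum>s\<in>S. q s * e s x) \<partial>M) = (\<Sum>s\<in>S. q s * (\<integral>x. h x * e s x \<partial>M))"
proof -
  have "(\<integral>x. h x * (\<Sum>s\<in>S. q s * e s x) \<partial>M) = (\<integral>x. (\<Sum>s\<in>S. q s * (h x * e s x)) \<partial>M)"
    by (simp add: sum_distrib_left mult.left_commute)
  also have "\<dots> = (\<Sum>s\<in>S. q s * (\<integral>x. h x * e s x \<partial>M))"
    using assms by (subst Bochner_Integration.integral_sum) (simp_all add: square_integrable_mult)
  finally show ?thesis .
qed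

lemma integral_mult_eq_0_if_residual:
  assumes h: "square_integrable M h" and g: "square_integrable M g"
    and e: "\<And>s. s \<in> S \<Longrightarrow> square_integrable M (e s)"
    and orth: "\<And>s. s \<in> S \<Longrightarrow> (\<integral>x. h x * e s x \<partial>M) = 0"
      "(\<integral>x. h x * (g x - (\<Sum>s\<in>S. p s * e s x)) \<partial>M) = 0"
  shows "(\<integral>x. h x * g x \<partial>M) = 0"
proof -
  have sum: "square_integrable M (\<lambda>x. \<Sum>s\<in>S. p s * e s x)"
    using e by (intro square_integrable_sum square_integrable_cmult)
  have "(\<integral>x. h x * g x \<partial>M) =
      (\<integral>x. h x * (g x - (\<Sum>s\<in>S. p s * e s x)) + h x * (\<Sum>s\<in>S. p s * e s x) \<partial>M)"
    by (simp add: right_diff_distrib)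
  also have "\<dots> = (\<integral>x. h x * (g x - (\<Sum>s\<in>S. p s * e s x)) \<partial>M) + (\<integral>x. h x * (\<Sum>s\<in>S. p s * e s x) \<partial>M)"
    by (intro Bochner_Integration.integral_add square_integrable_mult square_integrable_diff h g sum)
  also have "\<dots> = 0"
    using orth e by (simp add: integral_mult_linear_combination[OF h])
  finally show ?thesis .
qed

lemma ex_orthogonal_multiple:
  assumes f: "square_integrable M f" and e: "square_integrable M e"
  shows "\<exists>a. (\<integral>x. (f x - a * e x) * e x \<partial>M) = 0"
proof (cases "(\<integral>x. e x * e x \<partial>M) = 0")
  case True
  then have "AE x in M. e x * e x = 0"
    by (subst (asm) integral_nonneg_eq_0_iff_AE) (simp_all add: square_integrable_mult e)
  then have "(\<integral>x. f x * e x \<partial>M) = (\<integral>x. 0 \<partial>M)"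
    using f e by (intro integral_cong_AE) auto
  then show ?thesis
    by (intro exI[of _ 0]) simp
next
  case False
  then show ?thesis
    by (intro exI[of _ "(\<integral>x. f x * e x \<partial>M) / (\<integral>x. e x * e x \<partial>M)"])
      (subst integral_diff_cmult_mult[OF f e e], simp)
qed

text \<open>Gram-Schmidt without normalisation, so that linearly dependent functions need no special
  treatment.\<close>

lemma ex_orthogonal_residual:
  assumes "finite S" "square_integrable M f" "\<And>s. s \<in> S \<Longrightarrow> square_integrable M (e s)"
  shows "\<exists>q. \<forall>s\<in>S. (\<integral>x. (f x - (\<Sum>r\<in>S. q r * e r x)) * e s x \<partial>M) = 0"
  using assms
proof (induction S arbitrary: f rule: finite_induct)
  case (insert s S)
  note e = insert.prems(2)
  obtain q where q: "\<And>r. r \<in> S \<Longrightarrow> (\<integral>x. (f x - (\<Sum>r\<in>S. q r * e r x)) * e r x \<partial>M) = 0"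
    using insert.IH[of f] insert.prems by auto
  obtain p where p: "\<And>r. r \<in> S \<Longrightarrow> (\<integral>x. (e s x - (\<Sum>r\<in>S. p r * e r x)) * e r x \<partial>M) = 0"
    using insert.IH[of "e s"] e by auto
  define f' where "f' x = f x - (\<Sum>r\<in>S. q r * e r x)" for x
  define e' where "e' x = e s x - (\<Sum>r\<in>S. p r * e r x)" for x
  have f': "square_integrable M f'"
    unfolding f'_def using insert.prems
    by (intro square_integrable_diff square_integrable_sum square_integrable_cmult) auto
  have e': "square_integrable M e'"
    unfolding e'_def using e
    by (intro square_integrable_diff square_integrable_sum square_integrable_cmult) auto
  obtain a where a: "(\<integral>x. (f' x - a * e' x) * e' x \<partial>M) = 0"
    using ex_orthogonal_multiple[OF f' e'] by blast
  define h where "h x = f' x - a * e' x" for x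
  have h: "square_integrable M h"
    unfolding h_def by (intro square_integrable_diff square_integrable_cmult f' e')
  have h_orth_S: "(\<integral>x. h x * e r x \<partial>M) = 0" if "r \<in> S" for r
    using q[OF that] p[OF that] that e
    by (simp add: h_def integral_diff_cmult_mult[OF f' e'] flip: f'_def e'_def)
  have h_orth_s: "(\<integral>x. h x * e s x \<partial>M) = 0"
  proof (rule integral_mult_eq_0_if_residual[OF h, where S=S and e=e])
    show "(\<integral>x. h x * (e s x - (\<Sum>r\<in>S. p r * e r x)) \<partial>M) = 0"
      using a by (simp only: h_def e'_def)
  qed (use e h_orth_S in auto)
  define q' where "q' = (\<lambda>r. q r - a * p r)(s := a)"
  have "h x = f x - (\<Sum>r\<in>insert s S. q' r * e r x)" for x
  proof -
    have "(\<Sum>r\<in>S. q' r * e r x) = (\<Sum>r\<in>S. (q r - a * p r) * e r x)"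
      using insert.hyps by (intro sum.cong) (auto simp: q'_def)
    then show ?thesis
      using insert.hyps by (simp add: h_def f'_def e'_def q'_def left_diff_distrib sum_subtractf
          sum_distrib_left algebra_simps)
  qed
  with h_orth_S h_orth_s show ?case
    by (intro exI[of _ q']) simp
qed simp

lemma integral_square_orthogonal_residual_le:
  assumes f: "square_integrable M f" and h: "square_integrable M h"
    and orth: "(\<integral>x. h x * (f x - h x) \<partial>M) = 0"
  shows "(\<integral>x. (h x)\<^sup>2 \<partial>M) \<le> (\<integral>x. (f x)\<^sup>2 \<partial>M)"
proof -
  have p: "square_integrable M (\<lambda>x. f x - h x)"
    by (rule square_integrable_diff[OF f h])
  have "(\<integral>x. (f x)\<^sup>2 \<partial>M) = (\<integral>x. (h x)\<^sup>2 + 2 * (h x * (f x - h x)) + (f x - h x)\<^sup>2 \<partial>M)"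
    by (intro Bochner_Integration.integral_cong refl) (simp add: power2_eq_square algebra_simps)
  also have "\<dots> = (\<integral>x. (h x)\<^sup>2 \<partial>M) + (\<integral>x. (f x - h x)\<^sup>2 \<partial>M)"
    using h p square_integrable_mult[OF h p] orth by (simp add: square_integrable_def)
  finally show ?thesis
    by simp
qed

lemma second_moment_sum_le:
  assumes X: "\<And>i. i \<in> I \<Longrightarrow> square_integrable M (X i)" "\<And>i. i \<in> I \<Longrightarrow> (\<integral>\<omega>. (X i \<omega>)\<^sup>2 \<partial>M) \<le> v"
    and "finite I" "0 \<le> v"
    and few: "\<And>i. i \<in> I \<Longrightarrow> card {k\<in>I. (\<integral>\<omega>. X i \<omega> * X k \<omega> \<partial>M) \<noteq> 0} \<le> C"
  shows "(\<integral>\<omega>. (\<Sum>i\<in>I. X i \<omega>)\<^sup>2 \<partial>M) \<le> real (card I * C) * v"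
proof -
  have pair_le: "(\<integral>\<omega>. X i \<omega> * X k \<omega> \<partial>M) \<le> v" if "i \<in> I" "k \<in> I" for i k
  proof -
    have "(\<integral>\<omega>. X i \<omega> * X k \<omega> \<partial>M) \<le> (\<integral>\<omega>. ((X i \<omega>)\<^sup>2 + (X k \<omega>)\<^sup>2) / 2 \<partial>M)"
    proof (rule integral_mono)
      show "X i \<omega> * X k \<omega> \<le> ((X i \<omega>)\<^sup>2 + (X k \<omega>)\<^sup>2) / 2" for \<omega>
        using sum_squares_bound[of "X i \<omega>" "X k \<omega>"] by simp
    qed (use X(1) that in \<open>auto simp: square_integrable_mult square_integrable_def\<close>)
    also have "\<dots> = ((\<integral>\<omega>. (X i \<omega>)\<^sup>2 \<partial>M) + (\<integral>\<omega>. (X k \<omega>)\<^sup>2 \<partial>M)) / 2"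
      using X(1) that by (simp add: square_integrable_def)
    also have "\<dots> \<le> v"
      using X(2)[of i] X(2)[of k] that by simp
    finally show ?thesis .
  qed
  have "(\<integral>\<omega>. (\<Sum>i\<in>I. X i \<omega>)\<^sup>2 \<partial>M) = (\<integral>\<omega>. (\<Sum>i\<in>I. \<Sum>k\<in>I. X i \<omega> * X k \<omega>) \<partial>M)"
    by (simp add: power2_eq_square sum_product)
  also have "\<dots> = (\<Sum>i\<in>I. \<Sum>k\<in>I. \<integral>\<omega>. X i \<omega> * X k \<omega> \<partial>M)"
    using X(1) by (simp add: Bochner_Integration.integral_sum square_integrable_mult)
  also have "\<dots> \<le> (\<Sum>i\<in>I. real C * v)"
  proof (rule sum_mono)
    fix i assume i: "i \<in> I"
    let ?N = "{k\<in>I. (\<integral>\<omega>. X i \<omega> * X k \<omega> \<partial>M) \<noteq> 0}"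
    have "(\<Sum>k\<in>I. \<integral>\<omega>. X i \<omega> * X k \<omega> \<partial>M) = (\<Sum>k\<in>?N. \<integral>\<omega>. X i \<omega> * X k \<omega> \<partial>M)"
      using \<open>finite I\<close> by (intro sum.mono_neutral_right) auto
    also have "\<dots> \<le> real (card ?N) * v"
      using pair_le[OF i] by (intro sum_bounded_above) simp
    also have "\<dots> \<le> real C * v"
      using few[OF i] \<open>0 \<le> v\<close> by (intro mult_right_mono) simp_all
    finally show "(\<Sum>k\<in>I. \<integral>\<omega>. X i \<omega> * X k \<omega> \<partial>M) \<le> real C * v" .
  qed
  finally show ?thesis
    by (simp add: mult.assoc)
qed

section \<open>Redrawing coordinates of a product measure\<close>

lemma measurable_override_on [measurable]:
  "(\<lambda>(x, y). override_on x y J) \<in> measurable (PiM I M \<Otimes>\<^sub>M PiM I M) (PiM I M)"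
proof (rule measurable_PiM_single')
  fix i assume "i \<in> I"
  then show "(\<lambda>\<omega>. (case \<omega> of (x, y) \<Rightarrow> override_on x y J) i) \<in> measurable (PiM I M \<Otimes>\<^sub>M PiM I M) (M i)"
    by (cases "i \<in> J") (simp_all add: case_prod_beta)
qed (auto simp: space_pair_measure space_PiM PiE_iff extensional_def override_on_def)

lemma (in product_prob_space) distr_override_on:
  "distr (PiM I M \<Otimes>\<^sub>M PiM I M) (PiM I M) (\<lambda>(x, y). override_on x y J) = PiM I M"
    (is "distr ?PP _ ?m = _")
proof (rule PiM_eq)
  fix F X assume F: "finite F" "F \<subseteq> I" "\<And>i. i \<in> F \<Longrightarrow> X i \<in> sets (M i)"
  let ?S = "\<lambda>G. {x \<in> space (PiM I M). \<forall>i\<in>G. x i \<in> X i}"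
  have S: "?S G \<in> sets (PiM I M)" if "G \<subseteq> F" for G
    using that F finite_subset[OF that F(1)]
    by (intro sets.sets_Collect_finite_All) (auto intro!: sets_Collect_single')
  have "?m -` ?S F \<inter> space ?PP = ?S (F - J) \<times> ?S (F \<inter> J)"
    using F(2) by (auto simp: space_pair_measure space_PiM PiE_iff override_on_def extensional_def
        split: if_splits)
  then have "emeasure (distr ?PP (PiM I M) ?m) (?S F) =
      emeasure (PiM I M) (?S (F - J)) * emeasure (PiM I M) (?S (F \<inter> J))"
    using P.emeasure_pair_measure_Times[OF S S, of "F - J" "F \<inter> J"] S[of F]
    by (subst emeasure_distr) simp_all
  also have "\<dots> = (\<Prod>i\<in>F - J. emeasure (M i) (X i)) * (\<Prod>i\<in>F \<inter> J. emeasure (M i) (X i))"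
    using F by (subst (1 2) emeasure_PiM_Collect) auto
  also have "\<dots> = (\<Prod>i\<in>F. emeasure (M i) (X i))"
    using F(1) by (subst prod.union_disjoint[symmetric]) (auto intro!: prod.cong)
  finally show "emeasure (distr ?PP (PiM I M) ?m) (emb I F (PiE F X)) = (\<Prod>i\<in>F. emeasure (M i) (X i))"
    using F(2)
    by (simp add: prod_emb_def Pi_iff space_PiM Int_def conj_commute PiE_iff cong: rev_conj_cong)
qed simp

lemma (in product_prob_space) integral_override_on:
  fixes f :: "('i \<Rightarrow> 'a) \<Rightarrow> 'b::{banach, second_countable_topology}"
  assumes "integrable (PiM I M) f"
  shows "(\<integral>x. f x \<partial>PiM I M) = (\<integral>x. (\<integral>y. f (override_on x y J) \<partial>PiM I M) \<partial>PiM I M)"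
proof -
  interpret PP: pair_prob_space "PiM I M" "PiM I M" ..
  let ?m = "\<lambda>(x, y). override_on x y J"
  have [measurable]: "f \<in> borel_measurable (PiM I M)"
    using assms by simp
  have "integrable (distr (PiM I M \<Otimes>\<^sub>M PiM I M) (PiM I M) ?m) f"
    using assms by (simp only: distr_override_on)
  then have int: "integrable (PiM I M \<Otimes>\<^sub>M PiM I M) (\<lambda>p. f (?m p))"
    by (subst (asm) integrable_distr_eq) simp_all
  have "(\<integral>x. f x \<partial>PiM I M) = (\<integral>p. f (?m p) \<partial>(PiM I M \<Otimes>\<^sub>M PiM I M))"
    by (subst distr_override_on[of J, symmetric], subst integral_distr) simp_all
  also have "\<dots> = (\<integral>x. (\<integral>y. f (override_on x y J) \<partial>PiM I M) \<partial>PiM I M)"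
    using PP.integral_fst'[OF int] by simp
  finally show ?thesis .
qed

section \<open>Pairs of scrambled points\<close>

text \<open>The permutations are indexed by the nodes of \<open>b\<close>-ary trees, one for each coordinate. The
  descendants collect the nodes whose permutations act on the digits of \<open>x\<close> beyond the shape \<open>\<kappa>\<close>.\<close>

definition descendants :: "nat \<Rightarrow> ('d \<Rightarrow> nat) \<Rightarrow> real^'d \<Rightarrow> ('d \<times> nat list) set" where
  "descendants b \<kappa> x = {(j, p). take (\<kappa> j) p = digit_prefix b (x $ j) (\<kappa> j)}"

lemma digit_prefix_mem_descendants_iff:
  "(j, digit_prefix b y l) \<in> descendants b \<kappa> x \<longleftrightarrow>
    \<kappa> j \<le> l \<and> digit_prefix b y (\<kappa> j) = digit_prefix b (x $ j) (\<kappa> j)"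
proof (cases "\<kappa> j \<le> l")
  case False
  then have "take (\<kappa> j) (digit_prefix b y l) \<noteq> digit_prefix b (x $ j) (\<kappa> j)"
    by (auto dest: arg_cong[of _ _ length])
  with False show ?thesis
    by (simp add: descendants_def)
qed (simp add: descendants_def take_digit_prefix)

lemma scrambled_digit_override_descendants:
  "scrambled_digit b (override_on \<pi> \<pi>' (descendants b \<kappa> x)) j (x $ j) l =
    (if \<kappa> j \<le> l then scrambled_digit b \<pi>' j (x $ j) l else scrambled_digit b \<pi> j (x $ j) l)"
  by (simp add: scrambled_digit_def override_on_def digit_prefix_mem_descendants_iff)

lemma (in radix) scramble_override_descendants_eq:
  assumes "x \<in> unit_cube" "y \<in> unit_cube"
    and "\<And>j. cell_index b (\<kappa> j) (x $ j) \<noteq> cell_index b (\<kappa> j) (y $ j)"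
  shows "scramble b (override_on \<pi> \<pi>' (descendants b \<kappa> x)) y = scramble b \<pi> y"
proof -
  have "digit_prefix b (y $ j) (\<kappa> j) \<noteq> digit_prefix b (x $ j) (\<kappa> j)" for j
    using assms(1,2) assms(3)[of j] by (simp add: digit_prefix_eq_iff unit_cube_def)
  then have "scrambled_digit b (override_on \<pi> \<pi>' (descendants b \<kappa> x)) j (y $ j) =
      scrambled_digit b \<pi> j (y $ j)" for j
    by (simp add: scrambled_digit_def override_on_def digit_prefix_mem_descendants_iff fun_eq_iff)
  then show ?thesis
    by (simp add: vec_eq_iff scramble_nth)
qed

definition orthogonal_to_elem_intervals :: "nat \<Rightarrow> nat \<Rightarrow> (real^'d \<Rightarrow> real) \<Rightarrow> bool" where
  "orthogonal_to_elem_intervals b M h \<longleftrightarrow> (\<forall>I\<in>elem_intervals b M. (\<integral>u. h u * indicator I u \<partial>unif) = 0)"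

lemma integral_perm_space_override:
  fixes \<Phi> :: "('d::finite \<times> nat list \<Rightarrow> nat \<Rightarrow> nat) \<Rightarrow> real"
  assumes "integrable (perm_space b) \<Phi>"
  shows "(\<integral>\<pi>. \<Phi> \<pi> \<partial>perm_space b) =
    (\<integral>\<pi>. (\<integral>\<pi>'. \<Phi> (override_on \<pi> \<pi>' J) \<partial>perm_space b) \<partial>perm_space b)"
  using assms unfolding perm_space_def by (rule perm_pmfs.integral_override_on)

context radix
begin

lemma integral_scramble_digit_cylinder_eq_0:
  fixes x :: "real^'d"
  assumes h: "h \<in> borel_measurable borel" "orthogonal_to_elem_intervals b (\<Sum>j\<in>UNIV. \<kappa> j) h"
    and e: "\<And>j k. e j k < b"
  shows "(\<integral>\<rho>. h (scramble b \<rho> x) * indicator (digit_cylinder b x (leading_digits \<kappa>) e) \<rho> \<partial>perm_space b) = 0"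
    (is "(\<integral>\<rho>. _ * indicator ?C _ \<partial>_) = 0")
proof -
  let ?I = "elem_interval b \<kappa> (\<lambda>j. digit_value b (e j) (\<kappa> j))"
  have I: "?I \<in> elem_intervals b (\<Sum>j\<in>UNIV. \<kappa> j)"
    unfolding elem_intervals_def using digit_value_less[where d="e _", OF e] by blast
  note [measurable] = h(1) digit_cylinder_sets
  have "AE \<rho> in perm_space b. h (scramble b \<rho> x) * indicator ?C \<rho> =
      h (scramble b \<rho> x) * indicator ?I (scramble b \<rho> x)"
    using AE_regular_scrambling[of x]
    by eventually_elim (simp add: indicator_def scramble_mem_elem_interval_iff[OF _ e])
  then have "(\<integral>\<rho>. h (scramble b \<rho> x) * indicator ?C \<rho> \<partial>perm_space b) =
      (\<integral>\<rho>. h (scramble b \<rho> x) * indicator ?I (scramble b \<rho> x) \<partial>perm_space b)"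
    by (intro integral_cong_AE) simp_all
  also have "\<dots> = (\<integral>u. h u * indicator ?I u \<partial>unif)"
    by (intro integral_scramble) simp
  also have "\<dots> = 0"
    using h(2) I by (simp add: orthogonal_to_elem_intervals_def)
  finally show ?thesis .
qed

lemma integral_scramble_override_descendants_eq_0:
  fixes x :: "real^'d"
  assumes "h \<in> borel_measurable borel" "integrable unif h" "orthogonal_to_elem_intervals b (\<Sum>j\<in>UNIV. \<kappa> j) h"
    and perm: "\<And>i. \<pi> i permutes {..<b}"
  shows "(\<integral>\<pi>'. h (scramble b (override_on \<pi> \<pi>' (descendants b \<kappa> x)) x) \<partial>perm_space b) = 0"
proof -
  let ?ov = "\<lambda>\<rho> \<rho>'. override_on \<rho> \<rho>' (descendants b \<kappa> x)"
  let ?P = "perm_space b :: ('d \<times> nat list \<Rightarrow> nat \<Rightarrow> nat) measure"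
  define R where "R \<rho> = (\<integral>\<rho>'. h (scramble b (?ov \<rho> \<rho>') x) \<partial>?P)" for \<rho>
  define C where "C = digit_cylinder b x (leading_digits \<kappa>) (\<lambda>j. scrambled_digit b \<pi> j (x $ j))"
  have C_sets: "C \<in> sets ?P"
    unfolding C_def by (intro digit_cylinder_sets) simp
  have less: "scrambled_digit b \<pi> j y k < b" for j y k
    by (rule scrambled_digit_less[OF perm])
  have ov_C: "?ov \<rho> \<rho>' \<in> C \<longleftrightarrow> \<rho> \<in> C" for \<rho> \<rho>'
    by (auto simp: C_def digit_cylinder_def scrambled_digit_override_descendants)
  have R_eq: "R \<rho> = R \<pi>" if "\<rho> \<in> C" for \<rho>
  proof -
    have "scrambled_digit b (?ov \<rho> \<rho>') j (x $ j) = scrambled_digit b (?ov \<pi> \<rho>') j (x $ j)" for \<rho>' j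
      using that by (auto simp: C_def digit_cylinder_def scrambled_digit_override_descendants)
    then have "scramble b (?ov \<rho> \<rho>') x = scramble b (?ov \<pi> \<rho>') x" for \<rho>'
      by (simp add: vec_eq_iff scramble_nth)
    then show ?thesis
      by (simp add: R_def)
  qed
  have "R \<pi> * measure ?P C = (\<integral>\<rho>. R \<pi> * indicator C \<rho> \<partial>?P)"
    by simp
  also have "\<dots> = (\<integral>\<rho>. (\<integral>\<rho>'. h (scramble b (?ov \<rho> \<rho>') x) * indicator C (?ov \<rho> \<rho>') \<partial>?P) \<partial>?P)"
  proof (intro Bochner_Integration.integral_cong refl)
    show "R \<pi> * indicator C \<rho> = (\<integral>\<rho>'. h (scramble b (?ov \<rho> \<rho>') x) * indicator C (?ov \<rho> \<rho>') \<partial>?P)" for \<rho>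
      using R_eq[of \<rho>] by (cases "\<rho> \<in> C") (simp_all add: ov_C flip: R_def)
  qed
  also have "\<dots> = (\<integral>\<rho>. h (scramble b \<rho> x) * indicator C \<rho> \<partial>?P)"
    using assms by (intro integral_perm_space_override[symmetric] integrable_real_mult_indicator C_sets)
      (simp add: integrable_scramble_iff)
  also have "\<dots> = 0"
    unfolding C_def by (intro integral_scramble_digit_cylinder_eq_0 less assms)
  finally have "R \<pi> * measure ?P C = 0" .
  moreover have "0 < measure ?P C"
    unfolding C_def using base_pos by (subst prob_digit_cylinder) (simp_all add: less)
  ultimately show ?thesis
    by (simp add: R_def)
qed

lemma square_integrable_unif_measurable:
  "square_integrable unif h \<Longrightarrow> h \<in> borel_measurable borel"
  unfolding square_integrable_def by (simp cong: measurable_cong_sets)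

lemma square_integrable_scramble:
  fixes h :: "real^'d \<Rightarrow> real"
  assumes "square_integrable unif h"
  shows "square_integrable (perm_space b) (\<lambda>\<pi>. h (scramble b \<pi> x))"
proof -
  have [measurable]: "h \<in> borel_measurable borel"
    using assms by (rule square_integrable_unif_measurable)
  show ?thesis
    using assms integrable_scramble_iff[of "\<lambda>u. (h u)\<^sup>2" x] by (simp add: square_integrable_def)
qed

text \<open>Given all permutations other than those of the descendants, the scrambled \<open>y\<close> is fixed and
  the scrambled \<open>x\<close> is uniform in one elementary interval of shape \<open>\<kappa>\<close>.\<close>

lemma integral_scramble_pair_eq_0:
  fixes x y :: "real^'d"
  assumes "x \<in> unit_cube" "y \<in> unit_cube"
    and "\<And>j. cell_index b (\<kappa> j) (x $ j) \<noteq> cell_index b (\<kappa> j) (y $ j)"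
    and h: "square_integrable unif h" "orthogonal_to_elem_intervals b (\<Sum>j\<in>UNIV. \<kappa> j) h"
  shows "(\<integral>\<pi>. h (scramble b \<pi> x) * h (scramble b \<pi> y) \<partial>perm_space b) = 0"
proof -
  let ?P = "perm_space b :: ('d \<times> nat list \<Rightarrow> nat \<Rightarrow> nat) measure"
  let ?ov = "\<lambda>\<pi> \<pi>'. override_on \<pi> \<pi>' (descendants b \<kappa> x)"
  have "(\<integral>\<pi>. h (scramble b \<pi> x) * h (scramble b \<pi> y) \<partial>?P) =
      (\<integral>\<pi>. (\<integral>\<pi>'. h (scramble b (?ov \<pi> \<pi>') x) * h (scramble b (?ov \<pi> \<pi>') y) \<partial>?P) \<partial>?P)"
    by (intro integral_perm_space_override square_integrable_mult square_integrable_scramble h)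
  also have "\<dots> = (\<integral>\<pi>. (\<integral>\<pi>'. h (scramble b (?ov \<pi> \<pi>') x) \<partial>?P) * h (scramble b \<pi> y) \<partial>?P)"
    by (simp add: scramble_override_descendants_eq[OF assms(1-3)])
  also have "\<dots> = 0"
  proof (rule integral_eq_zero_AE)
    show "AE \<pi> in ?P. (\<integral>\<pi>'. h (scramble b (?ov \<pi> \<pi>') x) \<partial>?P) * h (scramble b \<pi> y) = 0"
      using AE_perm_space_permutes
    proof eventually_elim
      case (elim \<pi>)
      then have "(\<integral>\<pi>'. h (scramble b (?ov \<pi> \<pi>') x) \<partial>?P) = 0"
        by (intro integral_scramble_override_descendants_eq_0 unif.integrable_if_square_integrable
            square_integrable_unif_measurable h) blast
      then show ?case
        by simp
    qed
  qed
  finally show ?thesis .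
qed

end

section \<open>Points of a net that share long digit prefixes\<close>

lemma ex_sum_eq_between:
  fixes l u :: "'a \<Rightarrow> nat"
  assumes "finite A" "\<And>j. j \<in> A \<Longrightarrow> l j \<le> u j" "(\<Sum>j\<in>A. l j) \<le> M" "M \<le> (\<Sum>j\<in>A. u j)"
  shows "\<exists>\<kappa>. (\<forall>j\<in>A. l j \<le> \<kappa> j \<and> \<kappa> j \<le> u j) \<and> (\<Sum>j\<in>A. \<kappa> j) = M"
  using assms(3,4)
proof (induction M rule: dec_induct)
  case base
  then show ?case
    using assms(2) by (intro exI[of _ l]) simp
next
  case (step n)
  then obtain \<kappa> where \<kappa>: "\<forall>j\<in>A. l j \<le> \<kappa> j \<and> \<kappa> j \<le> u j" "(\<Sum>j\<in>A. \<kappa> j) = n"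
    by auto
  have "\<exists>j\<in>A. \<kappa> j < u j"
    using step.prems \<kappa>(2) sum_mono[of A u \<kappa>] by (metis Suc_n_not_le_n order_trans not_le)
  then obtain i where i: "i \<in> A" "\<kappa> i < u i"
    by blast
  have "(\<Sum>j\<in>A. (\<kappa>(i := Suc (\<kappa> i))) j) = Suc n"
    using assms(1) i(1) \<kappa>(2) by (simp add: sum.remove[of A i])
  with \<kappa>(1) i show ?case
    by (intro exI[of _ "\<kappa>(i := Suc (\<kappa> i))"]) (auto simp: le_SucI)
qed

lemma card_UN_le_mult:
  assumes "finite I" "card I \<le> N" "\<And>i. i \<in> I \<Longrightarrow> card (A i) \<le> C"
  shows "card (\<Union>i\<in>I. A i) \<le> N * C"
proof -
  have "card (\<Union>i\<in>I. A i) \<le> (\<Sum>i\<in>I. card (A i))"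
    by (rule card_UN_le[OF assms(1)])
  also have "\<dots> \<le> card I * C"
    using sum_bounded_above[of I "\<lambda>i. card (A i)" C] assms(3) by simp
  also have "\<dots> \<le> N * C"
    using assms(2) by simp
  finally show ?thesis .
qed

definition separated :: "nat \<Rightarrow> nat \<Rightarrow> real^'d \<Rightarrow> real^'d \<Rightarrow> bool" where
  "separated b M x y \<longleftrightarrow> (\<exists>\<kappa>. (\<Sum>j\<in>UNIV. \<kappa> j) = M \<and>
     (\<forall>j. cell_index b (\<kappa> j) (x $ j) \<noteq> cell_index b (\<kappa> j) (y $ j)))"

text \<open>For \<open>\<kappa> j = 0\<close> the truncated exponent \<open>\<kappa> j - 1\<close> is \<open>0\<close> and the condition is void on the unit cube.\<close>

definition near :: "nat \<Rightarrow> ('d \<Rightarrow> nat) \<Rightarrow> real^'d \<Rightarrow> real^'d \<Rightarrow> bool" where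
  "near b \<kappa> x y \<longleftrightarrow> (\<forall>j. cell_index b (\<kappa> j - 1) (x $ j) = cell_index b (\<kappa> j - 1) (y $ j))"

context radix
begin

lemma ex_near_if_not_separated:
  fixes x y :: "real^'d"
  assumes "x \<in> unit_cube" "y \<in> unit_cube" "\<not> separated b M x y"
  shows "\<exists>\<kappa>. (\<Sum>j\<in>UNIV. \<kappa> j) = M \<and> near b \<kappa> x y"
proof -
  define differ where "differ j k \<longleftrightarrow> cell_index b k (x $ j) \<noteq> cell_index b k (y $ j)" for j k
  have differ_mono: "differ j k'" if "differ j k" "k \<le> k'" for j k k'
    using that cell_index_eq_div[OF that(2)] by (auto simp: differ_def)
  define first where "first j = (LEAST k. differ j k \<or> M \<le> k)" for j
  have first: "differ j (first j) \<or> M \<le> first j" for j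
    unfolding first_def by (rule LeastI[of _ M]) simp
  have not_differ: "\<not> differ j k" if "k < first j" for j k
    using not_less_Least[of k "\<lambda>k. differ j k \<or> M \<le> k"] that unfolding first_def by blast
  have "M \<le> (\<Sum>j\<in>UNIV. first j)"
  proof (rule ccontr)
    assume small: "\<not> M \<le> (\<Sum>j\<in>UNIV. first j)"
    have "first j < M" for j
      using small member_le_sum[of j UNIV first] by simp
    then have "differ j (first j)" for j
      using first[of j] by (simp add: not_le[symmetric])
    moreover have "M \<le> (\<Sum>j\<in>UNIV. M + first j)"
      using member_le_sum[of undefined UNIV "\<lambda>j::'d. M + first j"] by simp
    then obtain \<kappa> where "\<And>j. first j \<le> \<kappa> j" "(\<Sum>j\<in>UNIV. \<kappa> j) = M"
      using ex_sum_eq_between[of UNIV first "\<lambda>j. M + first j" M] small by auto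
    ultimately show False
      using differ_mono assms(3) unfolding separated_def differ_def by blast
  qed
  then obtain \<kappa> where \<kappa>: "\<And>j. \<kappa> j \<le> first j" "(\<Sum>j\<in>UNIV. \<kappa> j) = M"
    using ex_sum_eq_between[of UNIV "\<lambda>_::'d. 0" first M] by auto
  have "\<not> differ j (\<kappa> j - 1)" for j
  proof (cases "\<kappa> j")
    case 0
    then show ?thesis
      using assms(1,2) by (simp add: differ_def unit_cube_def cell_index_0_eq)
  next
    case (Suc k)
    then show ?thesis
      using \<kappa>(1)[of j] by (intro not_differ) simp
  qed
  with \<kappa>(2) show ?thesis
    by (auto simp: near_def differ_def)
qed

lemma cell_index_refine:
  assumes "0 \<le> x" "x < 1"
  shows "nat (cell_index b K x) \<in>
    {b * nat (cell_index b (K - 1) x)..<b * nat (cell_index b (K - 1) x) + b}"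
proof (cases K)
  case 0
  then show ?thesis
    using assms base_pos by (simp add: cell_index_0_eq)
next
  case (Suc k)
  then show ?thesis
    using assms digit_less[of K x] by (simp add: cell_index_Suc nat_add_distrib nat_mult_distrib)
qed

lemma card_near_le:
  fixes x :: "nat \<Rightarrow> real^'d"
  assumes net: "is_net b t m x" and \<kappa>: "(\<Sum>j\<in>UNIV. \<kappa> j) = m - t" and i: "i < b ^ m"
  shows "card {k\<in>{..<b ^ m}. near b \<kappa> (x i) (x k)} \<le> b ^ CARD('d) * b ^ t"
proof -
  define a where "a j = nat (cell_index b (\<kappa> j - 1) (x i $ j))" for j
  let ?N = "{k\<in>{..<b ^ m}. near b \<kappa> (x i) (x k)}"
  let ?G = "PiE UNIV (\<lambda>j. {b * a j..<b * a j + b})"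
  define cs where "cs = {c \<in> ?G. \<forall>j. c j < b ^ \<kappa> j}"
  have fin: "finite ?G"
    by (intro finite_PiE) auto
  then have cs: "finite cs" "card cs \<le> b ^ CARD('d)"
    using card_mono[OF fin, of cs] by (auto simp: cs_def card_PiE)
  have x: "0 \<le> x k $ j" "x k $ j < 1" if "k < b ^ m" for k j
    using net that by (auto simp: is_net_def)
  have "?N \<subseteq> (\<Union>c\<in>cs. {k\<in>{..<b ^ m}. x k \<in> elem_interval b \<kappa> c})"
  proof
    fix k assume "k \<in> ?N"
    then have k: "k < b ^ m" and near: "near b \<kappa> (x i) (x k)"
      by auto
    define c where "c j = nat (cell_index b (\<kappa> j) (x k $ j))" for j
    have "c j \<in> {b * a j..<b * a j + b}" for j
      using cell_index_refine[OF x[OF k]] near by (simp add: c_def a_def near_def)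
    moreover have "c j < b ^ \<kappa> j" for j
      using x[OF k] base_pos by (simp add: c_def nat_less_iff)
    ultimately have "c \<in> cs"
      by (simp add: cs_def PiE_UNIV_domain)
    moreover have "x k \<in> elem_interval b \<kappa> c"
      using x[OF k] by (simp add: mem_elem_interval_iff c_def)
    ultimately show "k \<in> (\<Union>c\<in>cs. {k\<in>{..<b ^ m}. x k \<in> elem_interval b \<kappa> c})"
      using k by blast
  qed
  then have "card ?N \<le> card (\<Union>c\<in>cs. {k\<in>{..<b ^ m}. x k \<in> elem_interval b \<kappa> c})"
    using cs(1) by (intro card_mono) auto
  also have "\<dots> \<le> b ^ CARD('d) * b ^ t"
    using net \<kappa> by (intro card_UN_le_mult cs) (auto simp: cs_def is_net_def)
  finally show ?thesis .
qed

lemma card_not_separated_le: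
  fixes x :: "nat \<Rightarrow> real^'d"
  assumes net: "is_net b t m x" and i: "i < b ^ m"
  shows "card {k\<in>{..<b ^ m}. \<not> separated b (m - t) (x i) (x k)} \<le>
    (m + 1) ^ CARD('d) * (b ^ CARD('d) * b ^ t)"
proof -
  let ?shapes = "{\<kappa> :: 'd \<Rightarrow> nat. (\<Sum>j\<in>UNIV. \<kappa> j) = m - t}"
  let ?near = "\<lambda>\<kappa>. {k\<in>{..<b ^ m}. near b \<kappa> (x i) (x k)}"
  have "x k \<in> unit_cube" if "k < b ^ m" for k
    using net that by (simp add: is_net_def unit_cube_def)
  then have "\<exists>\<kappa>\<in>?shapes. near b \<kappa> (x i) (x k)" if "k < b ^ m" "\<not> separated b (m - t) (x i) (x k)" for k
    using ex_near_if_not_separated[of "x i" "x k" "m - t"] i that by simp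
  then have "{k\<in>{..<b ^ m}. \<not> separated b (m - t) (x i) (x k)} \<subseteq> (\<Union>\<kappa>\<in>?shapes. ?near \<kappa>)"
    by auto
  then have "card {k\<in>{..<b ^ m}. \<not> separated b (m - t) (x i) (x k)} \<le> card (\<Union>\<kappa>\<in>?shapes. ?near \<kappa>)"
    by (intro card_mono finite_UN_I finite_shapes) auto
  also have "\<dots> \<le> (m + 1) ^ CARD('d) * (b ^ CARD('d) * b ^ t)"
  proof (intro card_UN_le_mult finite_shapes)
    show "card ?shapes \<le> (m + 1) ^ CARD('d)"
      by (rule order_trans[OF card_shapes_le]) (simp add: power_mono)
    show "card (?near \<kappa>) \<le> b ^ CARD('d) * b ^ t" if "\<kappa> \<in> ?shapes" for \<kappa>
      using card_near_le[OF net _ i] that by simp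
  qed
  finally show ?thesis .
qed

end

section \<open>The variance of scrambled net means\<close>

definition sample_mean :: "nat \<Rightarrow> ('a \<Rightarrow> real) \<Rightarrow> (nat \<Rightarrow> 'a) \<Rightarrow> real" where
  "sample_mean n f u = (\<Sum>i<n. f (u i)) / real n"

lemma sample_mean_indicator:
  "sample_mean n (indicator A) u = real (card {i\<in>{..<n}. u i \<in> A}) / real n"
  by (simp add: sample_mean_def indicator_def sum.If_cases Int_def)

lemma sample_mean_add: "sample_mean n (\<lambda>x. f x + g x) u = sample_mean n f u + sample_mean n g u"
  by (simp add: sample_mean_def sum.distrib add_divide_distrib)

lemma sample_mean_linear_combination:
  "sample_mean n (\<lambda>x. \<Sum>s\<in>S. q s * e s x) u = (\<Sum>s\<in>S. q s * sample_mean n (e s) u)"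
  by (simp add: sample_mean_def sum_distrib_left sum_divide_distrib sum.swap[of _ S])

context radix
begin

lemma sample_mean_elem_intervals:
  fixes u :: "nat \<Rightarrow> real^'d"
  assumes net: "is_net b t m u" and I: "I \<in> elem_intervals b (m - t)"
  shows "sample_mean (b ^ m) (indicator I) u = (\<integral>v. indicator I v \<partial>unif)"
proof -
  have "sample_mean (b ^ m) (indicator I) u = real (b ^ t) / real (b ^ m)"
    using assms by (auto simp: sample_mean_indicator is_net_def elem_intervals_def)
  also have "\<dots> = 1 / real b ^ (m - t)"
    using net base_pos by (simp add: power_diff is_net_def)
  also have "\<dots> = measure unif I"
    by (rule measure_unif_elem_intervals[OF I, symmetric])
  finally show ?thesis
    using I by simp
qed

lemma square_integrable_elem_intervals:
  "I \<in> elem_intervals b M \<Longrightarrow> square_integrable unif (indicator I :: real^'d \<Rightarrow> real)"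
  by (intro unif.square_integrable_indicator) (simp add: elem_intervals_sets)

lemma sample_mean_elem_interval_combination:
  fixes u :: "nat \<Rightarrow> real^'d"
  assumes "is_net b t m u"
  shows "sample_mean (b ^ m) (\<lambda>x. \<Sum>I\<in>elem_intervals b (m - t). q I * indicator I x) u =
    (\<integral>v. (\<Sum>I\<in>elem_intervals b (m - t). q I * indicator I v) \<partial>unif)"
proof -
  have "sample_mean (b ^ m) (\<lambda>x. \<Sum>I\<in>elem_intervals b (m - t). q I * indicator I x) u =
      (\<Sum>I\<in>elem_intervals b (m - t). q I * (\<integral>v. indicator I v \<partial>unif))"
    unfolding sample_mean_linear_combination
    by (intro sum.cong refl) (simp only: sample_mean_elem_intervals[OF assms])
  also have "\<dots> = (\<integral>v. (\<Sum>I\<in>elem_intervals b (m - t). q I * indicator I v) \<partial>unif)"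
    by (subst Bochner_Integration.integral_sum)
      (intro integrable_mult_right unif.integrable_if_square_integrable
        square_integrable_elem_intervals, simp_all)
  finally show ?thesis .
qed

lemma ex_elem_interval_residual:
  fixes f :: "real^'d \<Rightarrow> real"
  assumes f: "square_integrable unif f"
  obtains h where "square_integrable unif h" "orthogonal_to_elem_intervals b (m - t) h"
    and "(\<integral>u. (h u)\<^sup>2 \<partial>unif) \<le> (\<integral>u. (f u)\<^sup>2 \<partial>unif)"
    and "\<And>u. is_net b t m u \<Longrightarrow>
      sample_mean (b ^ m) f u - (\<integral>v. f v \<partial>unif) = sample_mean (b ^ m) h u - (\<integral>v. h v \<partial>unif)"
proof -
  let ?S = "elem_intervals b (m - t) :: (real^'d) set set"
  note indicators = square_integrable_elem_intervals[where M="m - t"]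
  obtain q where q: "\<And>I. I \<in> ?S \<Longrightarrow>
      (\<integral>x. (f x - (\<Sum>J\<in>?S. q J * indicator J x)) * indicator I x \<partial>unif) = 0"
    using ex_orthogonal_residual[OF finite_elem_intervals[of b "m - t"] f, of indicator] indicators
    by blast
  define p where "p x = (\<Sum>J\<in>?S. q J * indicator J x)" for x
  define h where "h x = f x - p x" for x
  have p: "square_integrable unif p"
    unfolding p_def by (intro square_integrable_sum square_integrable_cmult indicators)
  have h: "square_integrable unif h"
    unfolding h_def by (intro square_integrable_diff f p)
  have h_orth: "(\<integral>x. h x * indicator I x \<partial>unif) = 0" if "I \<in> ?S" for I
    using q[OF that] by (simp add: h_def p_def)
  show ?thesis
  proof
    show "orthogonal_to_elem_intervals b (m - t) h"
      using h_orth by (simp add: orthogonal_to_elem_intervals_def)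
    have "(\<integral>x. h x * p x \<partial>unif) = 0"
      unfolding p_def
      by (subst integral_mult_linear_combination[OF h indicators]) (simp_all add: h_orth)
    then show "(\<integral>u. (h u)\<^sup>2 \<partial>unif) \<le> (\<integral>u. (f u)\<^sup>2 \<partial>unif)"
      by (intro integral_square_orthogonal_residual_le f h) (simp add: h_def)
    fix u :: "nat \<Rightarrow> real^'d" assume net: "is_net b t m u"
    have "sample_mean (b ^ m) p u = (\<integral>v. p v \<partial>unif)"
      using sample_mean_elem_interval_combination[OF net] by (simp only: p_def[abs_def])
    moreover have "sample_mean (b ^ m) f u = sample_mean (b ^ m) h u + sample_mean (b ^ m) p u"
      by (simp add: h_def flip: sample_mean_add)
    moreover have "(\<integral>v. h v \<partial>unif) = (\<integral>v. f v \<partial>unif) - (\<integral>v. p v \<partial>unif)"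
      unfolding h_def
      by (intro Bochner_Integration.integral_diff unif.integrable_if_square_integrable f p)
    ultimately show "sample_mean (b ^ m) f u - (\<integral>v. f v \<partial>unif) =
        sample_mean (b ^ m) h u - (\<integral>v. h v \<partial>unif)"
      by simp
  qed (rule h)
qed

lemma square_integrable_sample_mean_scramble:
  fixes f :: "real^'d \<Rightarrow> real"
  assumes "square_integrable unif f"
  shows "square_integrable (perm_space b) (\<lambda>\<pi>. sample_mean n f (\<lambda>i. scramble b \<pi> (x i)))"
  using square_integrable_cmult[OF square_integrable_sum[OF square_integrable_scramble[OF assms]],
      where c="1 / real n"]
  by (simp add: sample_mean_def)

lemma integrable_sample_mean_error_square:
  fixes f :: "real^'d \<Rightarrow> real"
  assumes "square_integrable unif f"
  shows "integrable (perm_space b) (\<lambda>\<pi>. (sample_mean n f (\<lambda>i. scramble b \<pi> (x i)) - c)\<^sup>2)"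
  using square_integrable_diff[OF square_integrable_sample_mean_scramble[OF assms], where g="\<lambda>_. c"]
  by (simp add: square_integrable_def)

lemma expectation_sample_mean_scramble:
  fixes f :: "real^'d \<Rightarrow> real"
  assumes f: "square_integrable unif f" and "0 < n"
  shows "(\<integral>\<pi>. sample_mean n f (\<lambda>i. scramble b \<pi> (x i)) \<partial>perm_space b) = (\<integral>u. f u \<partial>unif)"
proof -
  have "(\<integral>\<pi>. sample_mean n f (\<lambda>i. scramble b \<pi> (x i)) \<partial>perm_space b) =
      (\<Sum>i<n. \<integral>\<pi>. f (scramble b \<pi> (x i)) \<partial>perm_space b) / real n"
    by (simp add: sample_mean_def Bochner_Integration.integral_sum
        perm_space.integrable_if_square_integrable square_integrable_scramble f)
  with \<open>0 < n\<close> show ?thesis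
    by (simp add: integral_scramble square_integrable_unif_measurable[OF f])
qed

lemma second_moment_scrambled_net_sum_le:
  fixes x :: "nat \<Rightarrow> real^'d"
  assumes net: "is_net b t m x" and h: "square_integrable unif h"
    and orth: "orthogonal_to_elem_intervals b (m - t) h"
  shows "(\<integral>\<pi>. (\<Sum>i<b ^ m. h (scramble b \<pi> (x i)))\<^sup>2 \<partial>perm_space b) \<le>
    real (b ^ m * ((m + 1) ^ CARD('d) * (b ^ CARD('d) * b ^ t))) * (\<integral>u. (h u)\<^sup>2 \<partial>unif)"
proof -
  note [measurable] = square_integrable_unif_measurable[OF h]
  have x: "x i \<in> unit_cube" if "i < b ^ m" for i
    using net that by (simp add: is_net_def unit_cube_def)
  have uncorrelated: "(\<integral>\<pi>. h (scramble b \<pi> (x i)) * h (scramble b \<pi> (x k)) \<partial>perm_space b) = 0"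
    if "i < b ^ m" "k < b ^ m" "separated b (m - t) (x i) (x k)" for i k
  proof -
    obtain \<kappa> where \<kappa>: "(\<Sum>j\<in>UNIV. \<kappa> j) = m - t"
      "\<And>j. cell_index b (\<kappa> j) (x i $ j) \<noteq> cell_index b (\<kappa> j) (x k $ j)"
      using \<open>separated b (m - t) (x i) (x k)\<close> by (auto simp: separated_def)
    with orth that(1,2) show ?thesis
      by (intro integral_scramble_pair_eq_0[of _ _ \<kappa>] x h) simp_all
  qed
  have few_correlated: "card {k\<in>{..<b ^ m}.
        (\<integral>\<pi>. h (scramble b \<pi> (x i)) * h (scramble b \<pi> (x k)) \<partial>perm_space b) \<noteq> 0} \<le>
      (m + 1) ^ CARD('d) * (b ^ CARD('d) * b ^ t)" if "i < b ^ m" for i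
    using uncorrelated that by (intro order_trans[OF card_mono card_not_separated_le[OF net that]]) auto
  have "(\<integral>\<pi>. (\<Sum>i<b ^ m. h (scramble b \<pi> (x i)))\<^sup>2 \<partial>perm_space b) \<le>
      real (card {..<b ^ m} * ((m + 1) ^ CARD('d) * (b ^ CARD('d) * b ^ t))) * (\<integral>u. (h u)\<^sup>2 \<partial>unif)"
    using few_correlated
    by (intro second_moment_sum_le square_integrable_scramble h)
      (simp_all add: integral_scramble[of "\<lambda>u. (h u)\<^sup>2"])
  then show ?thesis
    by simp
qed

theorem scrambled_net_variance_le:
  fixes x :: "nat \<Rightarrow> real^'d"
  assumes net: "is_net b t m x" and f: "square_integrable unif f"
  shows "(\<integral>\<pi>. (sample_mean (b ^ m) f (\<lambda>i. scramble b \<pi> (x i)) - (\<integral>u. f u \<partial>unif))\<^sup>2 \<partial>perm_space b) \<le>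
    real ((m + 1) ^ CARD('d) * (b ^ CARD('d) * b ^ t)) / real b ^ m * (\<integral>u. (f u)\<^sup>2 \<partial>unif)"
proof -
  obtain h where h: "square_integrable unif h"
    and orth: "orthogonal_to_elem_intervals b (m - t) h"
    and h_le: "(\<integral>u. (h u)\<^sup>2 \<partial>unif) \<le> (\<integral>u. (f u)\<^sup>2 \<partial>unif)"
    and exact: "\<And>u. is_net b t m u \<Longrightarrow>
      sample_mean (b ^ m) f u - (\<integral>v. f v \<partial>unif) = sample_mean (b ^ m) h u - (\<integral>v. h v \<partial>unif)"
    using ex_elem_interval_residual[OF f, of m t] by blast
  let ?K = "(m + 1) ^ CARD('d) * (b ^ CARD('d) * b ^ t)"
  let ?mean = "\<lambda>f \<pi>. sample_mean (b ^ m) f (\<lambda>i. scramble b \<pi> (x i))"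
  note [measurable] = square_integrable_measurable[OF square_integrable_sample_mean_scramble[OF f]]
    square_integrable_measurable[OF square_integrable_sample_mean_scramble[OF h]]
  have "AE \<pi> in perm_space b. \<forall>i\<in>{..<b ^ m}. regular_scrambling b \<pi> (x i)"
    by (intro AE_finite_allI AE_regular_scrambling) simp
  then have "AE \<pi> in perm_space b. (?mean f \<pi> - (\<integral>u. f u \<partial>unif))\<^sup>2 = (?mean h \<pi> - (\<integral>u. h u \<partial>unif))\<^sup>2"
    by eventually_elim (simp add: exact[OF is_net_scramble[OF net]])
  then have "(\<integral>\<pi>. (?mean f \<pi> - (\<integral>u. f u \<partial>unif))\<^sup>2 \<partial>perm_space b) =
      (\<integral>\<pi>. (?mean h \<pi> - (\<integral>u. h u \<partial>unif))\<^sup>2 \<partial>perm_space b)"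
    by (intro integral_cong_AE) simp_all
  also have "\<dots> = perm_space.variance b (?mean h)"
    using h base_pos by (simp add: expectation_sample_mean_scramble)
  also have "\<dots> \<le> (\<integral>\<pi>. (?mean h \<pi>)\<^sup>2 \<partial>perm_space b)"
    using square_integrable_sample_mean_scramble[OF h]
    by (subst perm_space.variance_eq)
      (simp_all add: perm_space.integrable_if_square_integrable square_integrable_def)
  also have "\<dots> = (\<integral>\<pi>. (\<Sum>i<b ^ m. h (scramble b \<pi> (x i)))\<^sup>2 \<partial>perm_space b) / (real b ^ m)\<^sup>2"
    by (simp add: sample_mean_def power_divide)
  also have "\<dots> \<le> real (b ^ m * ?K) * (\<integral>u. (f u)\<^sup>2 \<partial>unif) / (real b ^ m)\<^sup>2"
    using second_moment_scrambled_net_sum_le[OF net h orth]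
      mult_left_mono[OF h_le, of "real (b ^ m * ?K)"]
    by (intro divide_right_mono) simp_all
  also have "\<dots> = real ?K / real b ^ m * (\<integral>u. (f u)\<^sup>2 \<partial>unif)"
    using base_pos by (simp add: power2_eq_square)
  finally show ?thesis .
qed

end

section \<open>Strong consistency of scrambled net means\<close>

lemma AE_tendsto_0_if_summable_integral:
  fixes f :: "nat \<Rightarrow> 'a \<Rightarrow> real"
  assumes f: "\<And>n. integrable M (f n)" "\<And>n x. 0 \<le> f n x" and "summable (\<lambda>n. \<integral>x. f n x \<partial>M)"
  shows "AE x in M. (\<lambda>n. f n x) \<longlonglongrightarrow> 0"
proof -
  note [measurable] = borel_measurable_integrable[OF f(1)]
  have "(\<integral>\<^sup>+x. (\<Sum>n. ennreal (f n x)) \<partial>M) = (\<Sum>n. \<integral>\<^sup>+x. ennreal (f n x) \<partial>M)"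
    by (intro nn_integral_suminf) simp
  also have "\<dots> = (\<Sum>n. ennreal (\<integral>x. f n x \<partial>M))"
    using f by (simp add: nn_integral_eq_integral)
  also have "\<dots> = ennreal (\<Sum>n. \<integral>x. f n x \<partial>M)"
    using assms by (intro suminf_ennreal2) simp_all
  finally have "AE x in M. (\<Sum>n. ennreal (f n x)) \<noteq> \<infinity>"
    by (intro nn_integral_PInf_AE) simp_all
  then show ?thesis
    by eventually_elim (use f(2) in \<open>auto intro!: summable_LIMSEQ_zero summable_suminf_not_top\<close>)
qed

lemma summable_power_mult_geometric:
  fixes r :: real
  assumes "0 \<le> r" "r < 1"
  shows "summable (\<lambda>n. real (n + 1) ^ d * r ^ n)"
proof -
  obtain c where c: "r < c" "c < 1"
    using dense[OF assms(2)] by blast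
  have "(\<lambda>n. (1 + inverse (real (Suc n))) ^ d * r) \<longlonglongrightarrow> (1 + 0) ^ d * r"
    by (intro tendsto_intros LIMSEQ_inverse_real_of_nat)
  then have "\<forall>\<^sub>F n in sequentially. (1 + inverse (real (Suc n))) ^ d * r < c"
    using c(1) by (intro order_tendstoD(2)) simp_all
  then obtain N where N: "\<And>n. N \<le> n \<Longrightarrow> (1 + inverse (real (Suc n))) ^ d * r < c"
    by (auto simp: eventually_sequentially)
  show ?thesis
  proof (rule summable_ratio_test[OF c(2)])
    fix n assume n: "N \<le> n"
    have "real (Suc n + 1) = real (n + 1) * (1 + inverse (real (Suc n)))"
      by (simp add: field_simps)
    then have "real (Suc n + 1) ^ d * r ^ Suc n =
        real (n + 1) ^ d * r ^ n * ((1 + inverse (real (Suc n))) ^ d * r)"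
      by (simp only: power_mult_distrib power_Suc mult_ac)
    also have "\<dots> \<le> real (n + 1) ^ d * r ^ n * c"
      using N[OF n] assms(1) by (intro mult_left_mono) simp_all
    finally show "norm (real (Suc n + 1) ^ d * r ^ Suc n) \<le> c * norm (real (n + 1) ^ d * r ^ n)"
      using assms(1) by (simp add: abs_mult mult.commute)
  qed
qed

lemma (in radix) summable_scrambled_net_variance_bound:
  "summable (\<lambda>m. real ((m + 1) ^ d * C) / real b ^ m * v)"
proof -
  have "summable (\<lambda>m. real (m + 1) ^ d * (1 / real b) ^ m * (real C * v))"
    using base_ge_2 by (intro summable_mult2 summable_power_mult_geometric) simp_all
  then show ?thesis
    by (simp add: power_divide mult_ac)
qed

locale scrambled_nets = radix b + prob_space M
  for b :: nat and M :: "'w measure" +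
  fixes t :: nat and P :: "nat \<Rightarrow> nat \<Rightarrow> real^'d"
    and Perm :: "nat \<Rightarrow> 'w \<Rightarrow> 'd \<times> nat list \<Rightarrow> nat \<Rightarrow> nat"
  assumes net: "t \<le> m \<Longrightarrow> is_net b t m (P m)"
    and measurable_Perm: "t \<le> m \<Longrightarrow> Perm m \<in> measurable M (perm_space b)"
    and distr_Perm: "t \<le> m \<Longrightarrow> distr M (perm_space b) (Perm m) = perm_space b"
begin

definition scrambled_point :: "nat \<Rightarrow> 'w \<Rightarrow> nat \<Rightarrow> real^'d" where
  "scrambled_point m \<omega> = (\<lambda>i. scramble b (Perm m \<omega>) (P m i))"

lemma AE_scrambled_point:
  assumes "t \<le> m" "AE u in unif. Q u" "{u. Q u} \<in> sets borel"
  shows "AE \<omega> in M. Q (scrambled_point m \<omega> i)"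
proof (unfold scrambled_point_def, rule AE_distrD[OF measurable_Perm])
  show "AE \<pi> in distr M (perm_space b) (Perm m). Q (scramble b \<pi> (P m i))"
    using AE_scramble[OF assms(2,3)] by (simp only: distr_Perm[OF assms(1)])
qed (rule assms)

lemma integrable_Perm:
  fixes \<Phi> :: "('d \<times> nat list \<Rightarrow> nat \<Rightarrow> nat) \<Rightarrow> real"
  assumes "t \<le> m" "integrable (perm_space b) \<Phi>"
  shows "integrable M (\<lambda>\<omega>. \<Phi> (Perm m \<omega>))"
  using integrable_distr[OF measurable_Perm, of m \<Phi>] assms by (simp add: distr_Perm)

lemma integral_Perm:
  fixes \<Phi> :: "('d \<times> nat list \<Rightarrow> nat \<Rightarrow> nat) \<Rightarrow> real"
  assumes "t \<le> m" "\<Phi> \<in> borel_measurable (perm_space b)"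
  shows "(\<integral>\<omega>. \<Phi> (Perm m \<omega>) \<partial>M) = (\<integral>\<pi>. \<Phi> \<pi> \<partial>perm_space b)"
  using integral_distr[OF measurable_Perm, of m \<Phi>] assms by (simp add: distr_Perm)

theorem AE_sample_mean_tendsto:
  assumes f: "square_integrable unif f"
  shows "AE \<omega> in M. (\<lambda>m. sample_mean (b ^ m) f (scrambled_point m \<omega>)) \<longlonglongrightarrow> (\<integral>u. f u \<partial>unif)"
proof -
  define err where
    "err m = (\<lambda>\<pi>. (sample_mean (b ^ m) f (\<lambda>i. scramble b \<pi> (P m i)) - (\<integral>u. f u \<partial>unif))\<^sup>2)" for m
  define bound where
    "bound = (\<lambda>m. real ((m + 1) ^ CARD('d) * (b ^ CARD('d) * b ^ t)) / real b ^ m *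
      (\<integral>u. (f u)\<^sup>2 \<partial>unif))"
  have err_nonneg: "0 \<le> err m \<pi>" for m \<pi>
    by (simp add: err_def)
  have err_integrable: "integrable (perm_space b) (err m)" for m
    unfolding err_def by (rule integrable_sample_mean_error_square[OF f])
  have integral_err_le: "(\<integral>\<omega>. err (m + t) (Perm (m + t) \<omega>) \<partial>M) \<le> bound (m + t)" for m
    using scrambled_net_variance_le[OF net f, of "m + t"] err_integrable
    by (subst integral_Perm) (simp_all add: err_def bound_def)
  have "summable (\<lambda>m. bound (m + t))"
    unfolding bound_def by (intro summable_ignore_initial_segment summable_scrambled_net_variance_bound)
  then have "summable (\<lambda>m. \<integral>\<omega>. err (m + t) (Perm (m + t) \<omega>) \<partial>M)"
    by (rule summable_comparison_test'[of _ 0]) (simp add: integral_err_le err_nonneg)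
  then have "AE \<omega> in M. (\<lambda>m. err (m + t) (Perm (m + t) \<omega>)) \<longlonglongrightarrow> 0"
    using integrable_Perm[OF le_add2 err_integrable] err_nonneg
    by (rule AE_tendsto_0_if_summable_integral[rotated 2])
  then show ?thesis
  proof eventually_elim
    case (elim \<omega>)
    have "(\<lambda>m. sqrt (err m (Perm m \<omega>))) \<longlonglongrightarrow> 0"
      using tendsto_real_sqrt[OF LIMSEQ_offset[where f="\<lambda>m. err m (Perm m \<omega>)", OF elim]] by simp
    then show ?case
      by (simp add: err_def scrambled_point_def tendsto_rabs_zero_iff LIM_zero_iff)
  qed
qed

end

section \<open>Quantiles\<close>

lemma quantile_le: "bdd_below {y. \<alpha> \<le> F y} \<Longrightarrow> \<alpha> \<le> F z \<Longrightarrow> quantile \<alpha> F \<le> z"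
  unfolding quantile_def by (intro cInf_lower) simp_all

lemma bdd_below_superlevel:
  fixes F :: "real \<Rightarrow> 'a::linorder"
  assumes "mono F" "F y < \<alpha>"
  shows "bdd_below {z. \<alpha> \<le> F z}"
  using assms
  by (intro bdd_belowI[of _ y]) (auto elim: mono_strict_invE intro: less_le_trans less_imp_le)

lemma le_quantile:
  assumes "mono F" "F y < \<alpha>" "\<alpha> \<le> F z"
  shows "y \<le> quantile \<alpha> F"
  unfolding quantile_def using assms
  by (intro cInf_greatest) (auto elim: mono_strict_invE intro: less_le_trans less_imp_le)

lemma quantile_tendsto:
  fixes F :: "real \<Rightarrow> real"
  assumes mono: "\<And>n. mono (G n)"
    and conv: "\<And>y. y \<in> \<rat> \<Longrightarrow> (\<lambda>n. G n y) \<longlonglongrightarrow> F y"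
    and F: "\<And>y. y < v \<Longrightarrow> F y < \<alpha>" "\<And>y. v < y \<Longrightarrow> \<alpha> < F y"
  shows "(\<lambda>n. quantile \<alpha> (G n)) \<longlonglongrightarrow> v"
proof -
  have below: "\<forall>\<^sub>F n in sequentially. G n y < \<alpha>" if "y \<in> \<rat>" "y < v" for y
    using conv[OF that(1)] F(1)[OF that(2)] by (rule order_tendstoD(2))
  have above: "\<forall>\<^sub>F n in sequentially. \<alpha> < G n y" if "y \<in> \<rat>" "v < y" for y
    using conv[OF that(1)] F(2)[OF that(2)] by (rule order_tendstoD(1))
  obtain y\<^sub>0 z\<^sub>0 where y\<^sub>0: "y\<^sub>0 \<in> \<rat>" "y\<^sub>0 < v" and z\<^sub>0: "z\<^sub>0 \<in> \<rat>" "v < z\<^sub>0"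
    using Rats_dense_in_real[of "v - 1" v] Rats_dense_in_real[of v "v + 1"] by auto
  show ?thesis
  proof (rule order_tendstoI)
    fix a assume "a < v"
    then obtain y where y: "y \<in> \<rat>" "a < y" "y < v"
      using Rats_dense_in_real by blast
    show "\<forall>\<^sub>F n in sequentially. a < quantile \<alpha> (G n)"
      using below[OF y(1,3)] above[OF z\<^sub>0]
    proof eventually_elim
      case (elim n)
      then have "y \<le> quantile \<alpha> (G n)"
        using le_quantile[OF mono elim(1), of z\<^sub>0] by simp
      with y(2) show ?case
        by simp
    qed
  next
    fix a assume "v < a"
    then obtain z where z: "z \<in> \<rat>" "v < z" "z < a"
      using Rats_dense_in_real by blast
    show "\<forall>\<^sub>F n in sequentially. quantile \<alpha> (G n) < a"
      using below[OF y\<^sub>0] above[OF z(1,2)]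
    proof eventually_elim
      case (elim n)
      then have "quantile \<alpha> (G n) \<le> z"
        using quantile_le[OF bdd_below_superlevel[OF mono elim(1)]] by simp
      with z(3) show ?case
        by simp
    qed
  qed
qed

context real_distribution
begin

lemma mono_cdf: "mono (cdf M)"
  by (simp add: monoI cdf_nondecreasing)

lemma left_lim_cdf_le: "left_lim (cdf M) x \<le> cdf M x"
proof -
  have "left_lim (cdf M) x = measure M {..<x}"
    unfolding left_lim_def by (intro tendsto_Lim cdf_at_left) simp
  also have "\<dots> \<le> cdf M x"
    unfolding cdf_def by (intro finite_measure_mono) auto
  finally show ?thesis .
qed

lemma cdf_less_if_less_quantile:
  assumes "0 < \<alpha>" "y < quantile \<alpha> (cdf M)"
  shows "cdf M y < \<alpha>"
proof (rule ccontr)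
  assume "\<not> cdf M y < \<alpha>"
  moreover have "\<forall>\<^sub>F w in at_bot. cdf M w < \<alpha>"
    using cdf_lim_at_bot assms(1) by (rule order_tendstoD(2))
  then obtain w where "cdf M w < \<alpha>"
    using eventually_happens'[OF trivial_limit_at_bot_linorder] by blast
  ultimately have "quantile \<alpha> (cdf M) \<le> y"
    by (intro quantile_le bdd_below_superlevel mono_cdf) simp_all
  with assms(2) show False
    by simp
qed

lemma less_cdf_if_quantile_less:
  assumes unique: "\<And>x. left_lim (cdf M) x \<le> \<alpha> \<and> \<alpha> \<le> cdf M x \<longleftrightarrow> x = quantile \<alpha> (cdf M)"
    and "quantile \<alpha> (cdf M) < y"
  shows "\<alpha> < cdf M y"
proof (rule ccontr)
  assume "\<not> \<alpha> < cdf M y"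
  then have "left_lim (cdf M) y \<le> \<alpha>"
    using left_lim_cdf_le[of y] by simp
  moreover have "\<alpha> \<le> cdf M (quantile \<alpha> (cdf M))"
    using unique by blast
  then have "\<alpha> \<le> cdf M y"
    using cdf_nondecreasing[of "quantile \<alpha> (cdf M)" y] assms(2) by simp
  ultimately have "y = quantile \<alpha> (cdf M)"
    using unique by blast
  with assms(2) show False
    by simp
qed

end

lemma mono_emp_cdf: "mono (emp_cdf n L)"
  unfolding emp_cdf_def by (intro monoI divide_right_mono of_nat_mono card_mono) auto

context
  fixes g :: "real^'d \<Rightarrow> real"
  assumes g: "g \<in> borel_measurable (restrict_space lborel (box 0 One))"
begin

lemma sublevel_sets: "{u \<in> box 0 One. g u \<le> y} \<in> sets borel"
proof -
  have "{u \<in> space (restrict_space lborel (box 0 One)). g u \<le> y}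
      \<in> sets (restrict_space lborel (box 0 One))"
    using g by measurable
  then show ?thesis
    by (simp add: space_restrict_space sets_restrict_space_iff)
qed

lemma unif_cdf_eq_cdf: "unif_cdf g = cdf (distr (restrict_space unif (box 0 One)) borel g)"
  and real_distribution_distr_unif:
    "real_distribution (distr (restrict_space unif (box 0 One)) borel g)"
proof -
  let ?U = "restrict_space (unif :: (real^'d) measure) (box 0 One)"
  have [measurable]: "g \<in> borel_measurable ?U"
    using g by (subst measurable_cong_sets[OF sets_restrict_space_cong refl]) simp_all
  interpret prob_space ?U
    by (rule prob_space_restrict_space) (simp_all add: emeasure_lborel_unit_box)
  show "real_distribution (distr ?U borel g)"
    by (simp add: real_distribution_def real_distribution_axioms_def prob_space_distr)
  have "cdf (distr ?U borel g) y = measure ?U {u \<in> box 0 One. g u \<le> y}" for y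
    by (simp add: cdf_def measure_distr vimage_def Int_def space_restrict_space conj_commute)
  then show "unif_cdf g = cdf (distr ?U borel g)"
    by (auto simp: unif_cdf_def fun_eq_iff measure_restrict_space)
qed

end

lemma (in scrambled_nets) AE_emp_cdf_tendsto:
  assumes g: "g \<in> borel_measurable (restrict_space lborel (box 0 One))"
  shows "AE \<omega> in M. (\<lambda>m. emp_cdf (b ^ m) (\<lambda>i. g (scrambled_point m \<omega> i)) y) \<longlonglongrightarrow> unif_cdf g y"
proof -
  let ?S = "{u \<in> box 0 One. g u \<le> y}"
  have "square_integrable unif (indicator ?S)"
    using sublevel_sets[OF g] by (intro unif.square_integrable_indicator) simp
  then have "AE \<omega> in M. (\<lambda>m. sample_mean (b ^ m) (indicator ?S) (scrambled_point m \<omega>)) \<longlonglongrightarrow>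
      (\<integral>u. indicator ?S u \<partial>unif)"
    by (rule AE_sample_mean_tendsto)
  moreover have "AE \<omega> in M. t \<le> m \<longrightarrow> scrambled_point m \<omega> i \<in> box 0 One" for m i
    using AE_scrambled_point[OF _ AE_unif_unit_box, of m i] by (cases "t \<le> m") simp_all
  then have "AE \<omega> in M. \<forall>m i. t \<le> m \<longrightarrow> scrambled_point m \<omega> i \<in> box 0 One"
    by (simp add: AE_all_countable)
  ultimately show ?thesis
  proof eventually_elim
    case (elim \<omega>)
    have "sample_mean (b ^ m) (indicator ?S) (scrambled_point m \<omega>) =
        emp_cdf (b ^ m) (\<lambda>i. g (scrambled_point m \<omega> i)) y" if "t \<le> m" for m
      using elim(2) that by (simp add: sample_mean_indicator emp_cdf_def)
    then have "\<forall>\<^sub>F m in sequentially. sample_mean (b ^ m) (indicator ?S) (scrambled_point m \<omega>) =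
        emp_cdf (b ^ m) (\<lambda>i. g (scrambled_point m \<omega> i)) y"
      using eventually_ge_at_top[of t] by (rule eventually_mono[rotated])
    moreover have "(\<integral>u. indicator ?S u \<partial>unif) = unif_cdf g y"
      using sublevel_sets[OF g] by (simp add: unif_cdf_def)
    ultimately show ?case
      using elim(1) by (simp add: Lim_transform_eventually)
  qed
qed

theorem theorem1:
  fixes \<alpha> :: real and b t :: nat and \<Theta> :: "real set" and \<theta> :: real
    and g :: "real \<Rightarrow> real^'d \<Rightarrow> real"
    and M :: "'w measure"
    and P :: "nat \<Rightarrow> nat \<Rightarrow> real^'d"
    and Perm :: "nat \<Rightarrow> 'w \<Rightarrow> ('d \<times> nat list \<Rightarrow> nat \<Rightarrow> nat)"
  assumes "0 < \<alpha>" and "\<alpha> < 1" and "2 \<le> b"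
    and "\<theta> \<in> \<Theta>"
    and "\<forall>\<theta>\<in>\<Theta>. g \<theta> \<in> borel_measurable (restrict_space lborel (box 0 One))"
    and "\<forall>\<theta>\<in>\<Theta>. \<forall>x. (left_lim (unif_cdf (g \<theta>)) x \<le> \<alpha> \<and> \<alpha> \<le> unif_cdf (g \<theta>) x)
                         \<longleftrightarrow> x = quantile \<alpha> (unif_cdf (g \<theta>))"
    and "prob_space M"
    and "\<forall>m\<ge>t. is_net b t m (P m)"
    and "\<forall>m\<ge>t. Perm m \<in> measurable M (perm_space b) \<and> distr M (perm_space b) (Perm m) = perm_space b"
  shows "AE \<omega> in M.
           (\<lambda>m. quantile \<alpha> (emp_cdf (b ^ m) (\<lambda>i. g \<theta> (scramble b (Perm m \<omega>) (P m i)))))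
             \<longlonglongrightarrow> quantile \<alpha> (unif_cdf (g \<theta>))"
proof -
  interpret scrambled_nets b M t P Perm
    using assms(3,7-9) by (simp add: scrambled_nets_def radix_def scrambled_nets_axioms_def)
  let ?F = "unif_cdf (g \<theta>)"
  have g: "g \<theta> \<in> borel_measurable (restrict_space lborel (box 0 One))"
    using assms(4,5) by blast
  interpret loss: real_distribution "distr (restrict_space unif (box 0 One)) borel (g \<theta>)"
    by (rule real_distribution_distr_unif[OF g])
  have unique: "left_lim ?F x \<le> \<alpha> \<and> \<alpha> \<le> ?F x \<longleftrightarrow> x = quantile \<alpha> ?F" for x
    using assms(4,6) by blast
  have below: "?F y < \<alpha>" if "y < quantile \<alpha> ?F" for y
    using loss.cdf_less_if_less_quantile[OF assms(1)] that by (simp add: unif_cdf_eq_cdf[OF g])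
  have above: "\<alpha> < ?F y" if "quantile \<alpha> ?F < y" for y
    using loss.less_cdf_if_quantile_less[of \<alpha>] unique that by (simp add: unif_cdf_eq_cdf[OF g])
  have "AE \<omega> in M. \<forall>y\<in>\<rat>. (\<lambda>m. emp_cdf (b ^ m) (\<lambda>i. g \<theta> (scrambled_point m \<omega> i)) y) \<longlonglongrightarrow> ?F y"
    by (intro AE_ball_countable' AE_emp_cdf_tendsto g countable_rat)
  then show ?thesis
    unfolding scrambled_point_def
    by eventually_elim (rule quantile_tendsto[OF mono_emp_cdf _ below above], blast+)
qed

end
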